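(* Let $V$ be a finite-dimensional complex representation of a complex reductive group $G$ such that $\mathbb{C}(V)^G=\operatorname{Frac}(\mathbb{C}[V]^G)$. Suppose $\mathbb{C}[V]^G$ is a unique factorization domain and let $(Y,W)$ have the Galois restriction property. Then the following are equivalent. (1) $(Y,W)$ has the Chevalley restriction property. (2) $\mathbb{C}[Y]\subset \operatorname{PC}(\mathbb{C}[V]^G)$. (3) The canonical morphism $Y\to V/\!/G$ is surjective up to codimension two. (4) The canonical morphism $Y\to V/\!/G$ is surjective.
   Context: Varieties are over $\mathbb{C}$ and subvarieties are irreducible, so that function fields make sense. $\mathbb{C}[V]^G$ and $\mathbb{C}(V)^G$ are the ring of $G$-invariant polynomials and the field of $G$-invariant rational functions on $V$; $V/\!/G=\operatorname{mSpec}(\mathbb{C}[V]^G)$ (the variety of maximal ideals), and the canonical morphism $Y\to V/\!/G$ is the one induced by restriction $\mathbb{C}[V]^G\to\mathbb{C}[Y]$. Galois restriction property: for $Y\subset V$ a closed subvariety and $W$ a finite group acting faithfully on $Y$ by birational automorphisms, $(Y,W)$ has this property if restriction of functions gives an isomorphism $\mathbb{C}(V)^G\to\mathbb{C}(Y)^W$. In that case $\mathbb{C}(Y)$ is a finite Galois extension of $\mathbb{C}(V)^G$, and one regards $\mathbb{C}[V]^G\subseteq\mathbb{C}[Y]\subseteq\mathbb{C}(Y)\subseteq K:=\overline{\mathbb{C}(V)^G}$ (algebraic closure) by fixing an embedding $\mathbb{C}(Y)\to K$ over $\mathbb{C}(V)^G$. Chevalley restriction property: for $Y\subset V$ a closed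 subvariety and $W$ a finite group acting faithfully on $Y$ by regular automorphisms, $(Y,W)$ has this property if restriction of functions is an isomorphism $\mathbb{C}[V]^G\to\mathbb{C}[Y]^W$. Positive closure: for an integral domain $R$, $\operatorname{PC}(R)=\{s\in\overline{\operatorname{Frac}R} : R[s]\cap\operatorname{Frac}R=R\}$. A morphism of varieties $\pi:X\to Z$ is surjective up to codimension two if every irreducible component of the Zariski closure $\overline{Z\setminus\operatorname{im}\pi}$ has codimension at least $2$ in $Z$.
   Formalization: W is additionally assumed to act on Y by regular automorphisms, as the Chevalley restriction property presupposes; for merely birational actions the equivalence fails (e.g. SL_2 on C^2 trivial + C^2 standard, Y: ax^2+bx+1=0, where (3) holds but (4) fails). *)

theory Defs
  imports "HOL-Analysis.Analysis" "HOL-Algebra.Algebra"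
begin

section \<open>Algebras of functions and Zariski topologies\<close>

inductive_set fun_algebra :: "('a \<Rightarrow> complex) set \<Rightarrow> ('a \<Rightarrow> complex) set"
  for S :: "('a \<Rightarrow> complex) set"
where
  const: "(\<lambda>_. c) \<in> fun_algebra S"
| gen: "f \<in> S \<Longrightarrow> f \<in> fun_algebra S"
| add: "f \<in> fun_algebra S \<Longrightarrow> g \<in> fun_algebra S \<Longrightarrow> (\<lambda>x. f x + g x) \<in> fun_algebra S"
| mult: "f \<in> fun_algebra S \<Longrightarrow> g \<in> fun_algebra S \<Longrightarrow> (\<lambda>x. f x * g x) \<in> fun_algebra S"

text \<open>
  Polynomials on a vector space with scalar multiplication \<open>s\<close>, as functions (the field is
  infinite). No basis is needed, and the zero space is included.
\<close>

definition polynomial_functions :: "(complex \<Rightarrow> 'v \<Rightarrow> 'v) \<Rightarrow> ('v::ab_group_add \<Rightarrow> complex) set" where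
  "polynomial_functions s = fun_algebra {l. Vector_Spaces.linear s (*) l}"

definition zariski_topology :: "('a \<Rightarrow> complex) set \<Rightarrow> 'a topology" where
  "zariski_topology P = topology_generated_by {{x. f x \<noteq> 0} | f. f \<in> P}"

definition irreducible_subset :: "'a topology \<Rightarrow> 'a set \<Rightarrow> bool" where
  "irreducible_subset T S \<longleftrightarrow> S \<subseteq> topspace T \<and> S \<noteq> {} \<and>
     (\<forall>A B. closedin T A \<and> closedin T B \<and> S \<subseteq> A \<union> B \<longrightarrow> S \<subseteq> A \<or> S \<subseteq> B)"

definition irreducible_component :: "'a topology \<Rightarrow> 'a set \<Rightarrow> 'a set \<Rightarrow> bool" where
  "irreducible_component T S C \<longleftrightarrow> irreducible_subset T C \<and> C \<subseteq> S \<and>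
     (\<forall>D. irreducible_subset T D \<and> C \<subseteq> D \<and> D \<subseteq> S \<longrightarrow> D = C)"

definition codimension :: "'a topology \<Rightarrow> 'a set \<Rightarrow> enat" where
  "codimension T S = Sup {enat n | n. \<exists>C :: nat \<Rightarrow> 'a set.
     C 0 = S \<and> (\<forall>i\<le>n. closedin T (C i) \<and> irreducible_subset T (C i)) \<and> (\<forall>i<n. C i \<subset> C (Suc i))}"

definition closed_subvariety :: "('v \<Rightarrow> complex) set \<Rightarrow> 'v set \<Rightarrow> bool" where
  "closed_subvariety P Y \<longleftrightarrow>
     closedin (zariski_topology P) Y \<and> irreducible_subset (zariski_topology P) Y"


section \<open>Reductive groups and their representations\<close>

definition GL :: "(complex^'m^'m) monoid" where
  "GL = \<lparr>carrier = {A. invertible A}, mult = (**), one = mat 1\<rparr>"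

definition GL_regular_functions :: "(complex^'m^'m \<Rightarrow> complex) set" where
  "GL_regular_functions =
     fun_algebra ({\<lambda>A. A $ i $ k | i k. True} \<union> {\<lambda>A. inverse (det A)})"

definition GL_topology :: "(complex^'m^'m) topology" where
  "GL_topology = subtopology (zariski_topology GL_regular_functions) (carrier GL)"

definition linear_algebraic_group :: "(complex^'m^'m) set \<Rightarrow> bool" where
  "linear_algebraic_group G \<longleftrightarrow> subgroup G GL \<and> closedin GL_topology G"

definition unipotent :: "complex^'m^'m \<Rightarrow> bool" where
  "unipotent A \<longleftrightarrow> (\<exists>k::nat. (((**) (A - mat 1)) ^^ k) (mat 1) = 0)"

text \<open>
  Triviality of the unipotent radical; connectedness of \<open>G\<close> is not required.
\<close>

definition reductive_group :: "(complex^'m^'m) set \<Rightarrow> bool" where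
  "reductive_group G \<longleftrightarrow> linear_algebraic_group G \<and>
     (\<forall>N. N \<lhd> (GL\<lparr>carrier := G\<rparr>) \<and> closedin GL_topology N \<and> connectedin GL_topology N \<and>
          (\<forall>A\<in>N. unipotent A) \<longrightarrow> N = {mat 1})"

definition rational_representation ::
  "(complex^'m^'m) set \<Rightarrow> (complex \<Rightarrow> 'v \<Rightarrow> 'v) \<Rightarrow> (complex^'m^'m \<Rightarrow> 'v::ab_group_add \<Rightarrow> 'v) \<Rightarrow> bool"
where
  "rational_representation G s \<rho> \<longleftrightarrow>
     (\<forall>g\<in>G. Vector_Spaces.linear s s (\<rho> g)) \<and>
     \<rho> (mat 1) = id \<and> (\<forall>g\<in>G. \<forall>h\<in>G. \<rho> (g ** h) = \<rho> g \<circ> \<rho> h) \<and>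
     (\<forall>l v. Vector_Spaces.linear s (*) l \<longrightarrow>
        (\<exists>f\<in>GL_regular_functions. \<forall>g\<in>G. l (\<rho> g v) = f g))"


section \<open>Coordinate rings and function fields\<close>

definition coordinate_ring :: "('v \<Rightarrow> complex) set \<Rightarrow> 'v set \<Rightarrow> ('v \<Rightarrow> complex) ring" where
  "coordinate_ring P Y =
     \<lparr>carrier = (\<lambda>f. restrict f Y) ` P,
      mult = (\<lambda>f g. \<lambda>x\<in>Y. f x * g x), one = (\<lambda>x\<in>Y. 1),
      ring.zero = (\<lambda>x\<in>Y. 0), ring.add = (\<lambda>f g. \<lambda>x\<in>Y. f x + g x)\<rparr>"

definition fraction :: "('a, 'b) ring_scheme \<Rightarrow> 'a \<Rightarrow> 'a \<Rightarrow> ('a \<times> 'a) set" where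
  "fraction R a b = {(c, d). c \<in> carrier R \<and> d \<in> carrier R - {\<zero>\<^bsub>R\<^esub>} \<and> a \<otimes>\<^bsub>R\<^esub> d = c \<otimes>\<^bsub>R\<^esub> b}"

text \<open>
  The unions below are over classes that do not depend on the chosen representatives.
\<close>

definition fraction_field :: "('a, 'b) ring_scheme \<Rightarrow> ('a \<times> 'a) set ring" where
  "fraction_field R =
     \<lparr>carrier = {fraction R a b | a b. a \<in> carrier R \<and> b \<in> carrier R - {\<zero>\<^bsub>R\<^esub>}},
      mult = (\<lambda>x y. \<Union>(a, b)\<in>x. \<Union>(c, d)\<in>y. fraction R (a \<otimes>\<^bsub>R\<^esub> c) (b \<otimes>\<^bsub>R\<^esub> d)),
      one = fraction R \<one>\<^bsub>R\<^esub> \<one>\<^bsub>R\<^esub>,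
      ring.zero = fraction R \<zero>\<^bsub>R\<^esub> \<one>\<^bsub>R\<^esub>,
      ring.add = (\<lambda>x y. \<Union>(a, b)\<in>x. \<Union>(c, d)\<in>y.
               fraction R (a \<otimes>\<^bsub>R\<^esub> d \<oplus>\<^bsub>R\<^esub> c \<otimes>\<^bsub>R\<^esub> b) (b \<otimes>\<^bsub>R\<^esub> d))\<rparr>"

definition as_fraction :: "('a, 'b) ring_scheme \<Rightarrow> 'a \<Rightarrow> ('a \<times> 'a) set" where
  "as_fraction R a = fraction R a \<one>\<^bsub>R\<^esub>"

definition function_field ::
  "('v \<Rightarrow> complex) set \<Rightarrow> 'v set \<Rightarrow> (('v \<Rightarrow> complex) \<times> ('v \<Rightarrow> complex)) set ring" where
  "function_field P Y = fraction_field (coordinate_ring P Y)"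

text \<open>
  The partial function given by an element of the function field, on its full domain of definition.
\<close>

definition rational_function ::
  "'v set \<Rightarrow> (('v \<Rightarrow> complex) \<times> ('v \<Rightarrow> complex)) set \<Rightarrow> 'v \<rightharpoonup> complex" where
  "rational_function Y q = (\<lambda>x.
     if x \<in> Y \<and> (\<exists>(a, b)\<in>q. b x \<noteq> 0)
     then Some (THE z. \<exists>(a, b)\<in>q. b x \<noteq> 0 \<and> z = a x / b x) else None)"

text \<open>
  Equality of partial functions on a nonempty open, hence (for irreducible \<open>Y\<close>) dense, subset of \<open>Y\<close>.
\<close>

definition generically_equal ::
  "('v \<Rightarrow> complex) set \<Rightarrow> 'v set \<Rightarrow> ('v \<rightharpoonup> 'c) \<Rightarrow> ('v \<rightharpoonup> 'c) \<Rightarrow> bool" where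
  "generically_equal P Y f g \<longleftrightarrow>
     (\<exists>U. openin (subtopology (zariski_topology P) Y) U \<and> U \<noteq> {} \<and>
          U \<subseteq> dom f \<inter> dom g \<and> (\<forall>x\<in>U. f x = g x))"


section \<open>Regular and birational actions\<close>

definition regular_on :: "('v \<Rightarrow> complex) set \<Rightarrow> 'v set \<Rightarrow> 'v set \<Rightarrow> ('v \<Rightarrow> complex) \<Rightarrow> bool" where
  "regular_on P Y U f \<longleftrightarrow>
     (\<forall>x\<in>U. \<exists>O'. openin (subtopology (zariski_topology P) Y) O' \<and> x \<in> O' \<and> O' \<subseteq> U \<and>
        (\<exists>a\<in>P. \<exists>b\<in>P. \<forall>y\<in>O'. b y \<noteq> 0 \<and> f y = a y / b y))"

text \<open>
  A rational map from \<open>Y\<close> to itself is represented by a morphism to \<open>Y\<close> from a nonempty open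
  subset of \<open>Y\<close>.
\<close>

definition rational_self_map :: "('v \<Rightarrow> complex) set \<Rightarrow> 'v set \<Rightarrow> ('v \<rightharpoonup> 'v) \<Rightarrow> bool" where
  "rational_self_map P Y \<phi> \<longleftrightarrow>
     openin (subtopology (zariski_topology P) Y) (dom \<phi>) \<and> dom \<phi> \<noteq> {} \<and> ran \<phi> \<subseteq> Y \<and>
     (\<forall>f\<in>P. regular_on P Y (dom \<phi>) (\<lambda>x. f (the (\<phi> x))))"

definition birational_automorphism :: "('v \<Rightarrow> complex) set \<Rightarrow> 'v set \<Rightarrow> ('v \<rightharpoonup> 'v) \<Rightarrow> bool" where
  "birational_automorphism P Y \<phi> \<longleftrightarrow> rational_self_map P Y \<phi> \<and>
     (\<exists>\<psi>. rational_self_map P Y \<psi> \<and>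
        generically_equal P Y (\<phi> \<circ>\<^sub>m \<psi>) Some \<and> generically_equal P Y (\<psi> \<circ>\<^sub>m \<phi>) Some)"

definition regular_automorphism :: "('v \<Rightarrow> complex) set \<Rightarrow> 'v set \<Rightarrow> ('v \<rightharpoonup> 'v) \<Rightarrow> bool" where
  "regular_automorphism P Y \<phi> \<longleftrightarrow> rational_self_map P Y \<phi> \<and> dom \<phi> = Y \<and>
     (\<exists>\<psi>. rational_self_map P Y \<psi> \<and> dom \<psi> = Y \<and>
        (\<forall>x\<in>Y. (\<phi> \<circ>\<^sub>m \<psi>) x = Some x \<and> (\<psi> \<circ>\<^sub>m \<phi>) x = Some x))"

definition faithful_birational_action ::
  "('v \<Rightarrow> complex) set \<Rightarrow> 'v set \<Rightarrow> ('w, 'b) monoid_scheme \<Rightarrow> ('w \<Rightarrow> 'v \<rightharpoonup> 'v) \<Rightarrow> bool" where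
  "faithful_birational_action P Y W \<phi> \<longleftrightarrow>
     (\<forall>w\<in>carrier W. birational_automorphism P Y (\<phi> w)) \<and>
     (\<forall>w\<in>carrier W. \<forall>w'\<in>carrier W.
        generically_equal P Y (\<phi> (w \<otimes>\<^bsub>W\<^esub> w')) (\<phi> w \<circ>\<^sub>m \<phi> w')) \<and>
     (\<forall>w\<in>carrier W. generically_equal P Y (\<phi> w) Some \<longleftrightarrow> w = \<one>\<^bsub>W\<^esub>)"

definition faithful_regular_action ::
  "('v \<Rightarrow> complex) set \<Rightarrow> 'v set \<Rightarrow> ('w, 'b) monoid_scheme \<Rightarrow> ('w \<Rightarrow> 'v \<rightharpoonup> 'v) \<Rightarrow> bool" where
  "faithful_regular_action P Y W \<phi> \<longleftrightarrow>
     (\<forall>w\<in>carrier W. regular_automorphism P Y (\<phi> w)) \<and>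
     (\<forall>w\<in>carrier W. \<forall>w'\<in>carrier W. \<phi> (w \<otimes>\<^bsub>W\<^esub> w') = \<phi> w \<circ>\<^sub>m \<phi> w') \<and>
     (\<forall>w\<in>carrier W. (\<forall>x\<in>Y. \<phi> w x = Some x) \<longleftrightarrow> w = \<one>\<^bsub>W\<^esub>)"


section \<open>Invariants and restriction\<close>

text \<open>
  \<open>\<Gamma>\<close> is the set of (possibly partial) transformations of \<open>Y\<close> by which a group acts.
\<close>

definition invariant_ring ::
  "('v \<Rightarrow> complex) set \<Rightarrow> 'v set \<Rightarrow> ('v \<rightharpoonup> 'v) set \<Rightarrow> ('v \<Rightarrow> complex) ring" where
  "invariant_ring P Y \<Gamma> = (coordinate_ring P Y)\<lparr>carrier :=
     {f \<in> carrier (coordinate_ring P Y). \<forall>\<gamma>\<in>\<Gamma>. \<forall>x\<in>Y. \<forall>y. \<gamma> x = Some y \<longrightarrow> f y = f x}\<rparr>"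

definition invariant_field ::
  "('v \<Rightarrow> complex) set \<Rightarrow> 'v set \<Rightarrow> ('v \<rightharpoonup> 'v) set \<Rightarrow>
    (('v \<Rightarrow> complex) \<times> ('v \<Rightarrow> complex)) set ring" where
  "invariant_field P Y \<Gamma> = (function_field P Y)\<lparr>carrier :=
     {q \<in> carrier (function_field P Y). \<forall>\<gamma>\<in>\<Gamma>.
        generically_equal P Y (rational_function Y q \<circ>\<^sub>m \<gamma>) (rational_function Y q)}\<rparr>"

definition group_maps :: "'g set \<Rightarrow> ('g \<Rightarrow> 'v \<Rightarrow> 'v) \<Rightarrow> ('v \<rightharpoonup> 'v) set" where
  "group_maps G \<rho> = (\<lambda>g. Some \<circ> \<rho> g) ` G"

text \<open>
  A rational function on the ambient space restricts to \<open>Y\<close> when it is defined somewhere on \<open>Y\<close>;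
  its restriction is then the unique \<open>h\<close> below.
\<close>

definition restricts_to where
  "restricts_to P Y q h \<longleftrightarrow> h \<in> carrier (function_field P Y) \<and>
     generically_equal P Y (rational_function UNIV q) (rational_function Y h)"

definition rational_restriction where
  "rational_restriction P Y q = (THE h. restricts_to P Y q h)"

definition galois_restriction_property ::
  "('v \<Rightarrow> complex) set \<Rightarrow> ('v \<rightharpoonup> 'v) set \<Rightarrow> 'v set \<Rightarrow>
    ('w, 'b) monoid_scheme \<Rightarrow> ('w \<Rightarrow> 'v \<rightharpoonup> 'v) \<Rightarrow> bool" where
  "galois_restriction_property P \<Gamma> Y W \<phi> \<longleftrightarrow>
     closed_subvariety P Y \<and> group W \<and> finite (carrier W) \<and> faithful_birational_action P Y W \<phi> \<and>
     (\<forall>q\<in>carrier (invariant_field P UNIV \<Gamma>). \<exists>h. restricts_to P Y q h) \<and>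
     rational_restriction P Y \<in>
       ring_iso (invariant_field P UNIV \<Gamma>) (invariant_field P Y (\<phi> ` carrier W))"

text \<open>
  Unlike the preceding property, this one concerns only actions by regular automorphisms.
\<close>

definition chevalley_restriction_property ::
  "('v \<Rightarrow> complex) set \<Rightarrow> ('v \<rightharpoonup> 'v) set \<Rightarrow> 'v set \<Rightarrow>
    ('w, 'b) monoid_scheme \<Rightarrow> ('w \<Rightarrow> 'v \<rightharpoonup> 'v) \<Rightarrow> bool" where
  "chevalley_restriction_property P \<Gamma> Y W \<phi> \<longleftrightarrow>
     closed_subvariety P Y \<and> group W \<and> finite (carrier W) \<and> faithful_regular_action P Y W \<phi> \<and>
     (\<lambda>f. restrict f Y) \<in>
       ring_iso (invariant_ring P UNIV \<Gamma>) (invariant_ring P Y (\<phi> ` carrier W))"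


section \<open>Positive closure\<close>

text \<open>
  \<open>R\<close> is a subring of a field \<open>K\<close>, and \<open>K\<close> is meant to be an algebraic closure of the
  field of fractions of \<open>R\<close>, which is formed inside \<open>K\<close>.
\<close>

definition fractions_in :: "('k, 'b) ring_scheme \<Rightarrow> 'k set \<Rightarrow> 'k set" where
  "fractions_in K R = {a \<otimes>\<^bsub>K\<^esub> inv\<^bsub>K\<^esub> b | a b. a \<in> R \<and> b \<in> R - {\<zero>\<^bsub>K\<^esub>}}"

definition positive_closure :: "('k, 'b) ring_scheme \<Rightarrow> 'k set \<Rightarrow> 'k set" where
  "positive_closure K R = {x \<in> carrier K. ring.simple_extension K R x \<inter> fractions_in K R = R}"


section \<open>The quotient variety\<close>

definition mSpec :: "('a, 'b) ring_scheme \<Rightarrow> 'a set topology" where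
  "mSpec R = topology_generated_by {{\<mm>. maximalideal \<mm> R \<and> f \<notin> \<mm>} | f. f \<in> carrier R}"

text \<open>
  The preimage, under restriction of functions to \<open>Y\<close>, of the maximal ideal of the point \<open>y\<close>.
\<close>

definition quotient_morphism ::
  "('v \<Rightarrow> complex) set \<Rightarrow> ('v \<rightharpoonup> 'v) set \<Rightarrow> 'v set \<Rightarrow> 'v \<Rightarrow> ('v \<Rightarrow> complex) set" where
  "quotient_morphism P \<Gamma> Y y = {f \<in> carrier (invariant_ring P UNIV \<Gamma>). restrict f Y y = 0}"

definition surjective_onto :: "('x \<Rightarrow> 'z) \<Rightarrow> 'x set \<Rightarrow> 'z topology \<Rightarrow> bool" where
  "surjective_onto \<pi> Y Z \<longleftrightarrow> \<pi> ` Y = topspace Z"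

definition surjective_up_to_codim_two :: "('x \<Rightarrow> 'z) \<Rightarrow> 'x set \<Rightarrow> 'z topology \<Rightarrow> bool" where
  "surjective_up_to_codim_two \<pi> Y Z \<longleftrightarrow>
     (\<forall>C. irreducible_component Z (Z closure_of (topspace Z - \<pi> ` Y)) C \<longrightarrow> 2 \<le> codimension Z C)"

end

theory Submission
  imports Defs "HOL-Library.Function_Algebras" "HOL-Computational_Algebra.Fundamental_Theorem_Algebra"
begin

text \<open>
  Restriction embeds \<open>A = C[V]^G\<close> into \<open>C[Y]^W\<close>, and the Galois property says that every element of
  \<open>C[Y]^W\<close> is a quotient of two elements of \<open>A\<close>; all four conditions are shown to be equivalent to
  \<open>A = C[Y]^W\<close>. For the positive closure this holds because \<open>C[Y] \<inter> Frac A = C[Y]^W\<close>. If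
  \<open>A = C[Y]^W\<close>, averaging over \<open>W\<close> shows that a maximal ideal of \<open>A\<close> generates a proper ideal of
  \<open>C[Y]\<close>, so it is the image of a point of \<open>Y\<close>. Conversely, if \<open>f = a / b\<close> is in \<open>C[Y]^W\<close> and a prime
  \<open>p\<close> divides \<open>b\<close> but not \<open>a\<close>, then \<open>Y\<close> misses \<open>V(p) - V(a)\<close>, whose closure is the divisor \<open>V(p)\<close>.

  The only form of the Nullstellensatz needed is the one for complex algebras of countable
  dimension, which also applies to \<open>A\<close>; so \<open>A\<close> need not be known to be finitely generated.
\<close>

section \<open>Irreducible components\<close>

text \<open>Elements of \<open>C[Y]\<close> are represented by polynomials on \<open>V\<close> that
  are compared only on \<open>Y\<close>. The hypotheses give local or generic information: a
  translate under \<open>W\<close> is locally a quotient, and invariance of a restricted function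
  holds on some open set. The first is made global by the Nullstellensatz, the second by
  irreducibility of \<open>Y\<close>. The equality \<open>C[Y] \<inter> Frac A = C[Y]^W\<close> is a
  cancellation: if \<open>f b = a\<close> with invariant \<open>a\<close> and \<open>b\<close>,
  every translate of \<open>f\<close> solves the same equation, and \<open>b\<close> is not zero on
  \<open>Y\<close>. It decides the positive closure because \<open>A[f]\<close> stays inside
  \<open>C[Y]\<close> for \<open>f\<close> in \<open>C[Y]\<close>. Factoriality enters twice: primes
  are cancelled from a denominator one at a time, and the divisor of a prime has codimension at most
  one. As the irreducible component around a missed divisor could a priori be larger than it, the
  codimension is bounded for every set containing the divisor. Points of the quotient are abstract
  maximal ideals of \<open>A\<close>. Complex characters supply enough of them, since
  \<open>A\<close> inherits a countable spanning set from \<open>C[V]\<close>.\<close>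

lemma openin_basis_refinement:
  assumes "openin (topology_generated_by S) U" "x \<in> U"
    and "\<And>b c. b \<in> S \<Longrightarrow> c \<in> S \<Longrightarrow> b \<inter> c \<in> S"
  obtains b where "b \<in> S" "x \<in> b" "b \<subseteq> U"
proof -
  have "generate_topology_on S U"
    using assms(1) by (rule openin_topology_generated_by)
  then have "\<exists>b\<in>S. x \<in> b \<and> b \<subseteq> U" using assms(2)
  proof (induction arbitrary: x rule: generate_topology_on.induct)
    \<comment> \<open>Closure under binary intersections turns the subbasis into a basis; this is
      the only case that uses it.\<close>
    case (Int a b)
    then obtain c d where "c \<in> S" "x \<in> c" "c \<subseteq> a" "d \<in> S" "x \<in> d" "d \<subseteq> b"
      by (metis IntD1 IntD2)
    then show ?case using assms(3)[of c d] by blast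
  next
    case (UN K)
    then obtain k where "k \<in> K" "x \<in> k" by blast
    with UN.IH[of k x] show ?case by blast
  qed blast+
  then show ?thesis using that by blast
qed

text \<open>Zorn's lemma applies because a chain of irreducible sets has irreducible union. The
  codimension condition speaks of components only, so an irreducible set found in the closure must
  first be placed inside one.\<close>

lemma irreducible_component_exists:
  assumes "irreducible_subset T D" "D \<subseteq> S"
  obtains C where "irreducible_component T S C" "D \<subseteq> C"
proof -
  let ?F = "{C. irreducible_subset T C \<and> D \<subseteq> C \<and> C \<subseteq> S}"
  have "\<exists>M\<in>?F. (\<forall>N\<in>?F. M \<subseteq> N \<longrightarrow> N = M)"
  proof (rule subset_Zorn_nonempty)
    show "?F \<noteq> {}" using assms by blast
    fix \<C> assume ne: "\<C> \<noteq> {}" and ch: "subset.chain ?F \<C>"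
    have mem: "\<And>C. C \<in> \<C> \<Longrightarrow> irreducible_subset T C \<and> D \<subseteq> C \<and> C \<subseteq> S"
      using ch by (auto simp: subset_chain_def)
    have lin: "\<And>C C'. C \<in> \<C> \<Longrightarrow> C' \<in> \<C> \<Longrightarrow> C \<subseteq> C' \<or> C' \<subseteq> C"
      using ch by (auto simp: subset_chain_def)
    have "\<Union>\<C> \<subseteq> Z \<or> \<Union>\<C> \<subseteq> Y" if "closedin T Z" "closedin T Y" "\<Union>\<C> \<subseteq> Z \<union> Y" for Z Y
    proof (rule ccontr)
      assume "\<not> ?thesis"
      then obtain C C' where C: "C \<in> \<C>" "C' \<in> \<C>" "\<not> C \<subseteq> Z" "\<not> C' \<subseteq> Y" by blast
      \<comment> \<open>The larger of two comparable members: it contains a point outside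
        \<open>Z\<close> and a point outside \<open>Y\<close>, although it is irreducible and
        covered by the two.\<close>
      define E where "E = C \<union> C'"
      have "E \<in> \<C>" using lin[OF C(1,2)] C(1,2) unfolding E_def
        by (metis Un_absorb1 Un_absorb2)
      then have "irreducible_subset T E" "E \<subseteq> Z \<union> Y" using mem that by blast+
      then have "E \<subseteq> Z \<or> E \<subseteq> Y" using that unfolding irreducible_subset_def by blast
      then show False using C E_def by blast
    qed
    moreover have "\<Union>\<C> \<subseteq> topspace T" "\<Union>\<C> \<noteq> {}" "D \<subseteq> \<Union>\<C>" "\<Union>\<C> \<subseteq> S"
      using mem ne unfolding irreducible_subset_def by blast+
    ultimately show "\<Union>\<C> \<in> ?F" unfolding irreducible_subset_def by blast
  qed
  then obtain M where M: "M \<in> ?F" "\<forall>N\<in>?F. M \<subseteq> N \<longrightarrow> N = M" by (rule bexE)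
  have "N = M" if "irreducible_subset T N" "M \<subseteq> N" "N \<subseteq> S" for N
    using bspec[OF M(2), of N] M(1) that by auto
  then have "irreducible_component T S M" using M(1) unfolding irreducible_component_def by auto
  with M(1) show ?thesis using that by blast
qed

section \<open>The Nullstellensatz for algebras of countable dimension\<close>

text \<open>Written as a product with a constant function, so that linear combinations unfold into
  expressions of the ring of functions.\<close>

definition fun_scale :: "complex \<Rightarrow> ('a \<Rightarrow> complex) \<Rightarrow> 'a \<Rightarrow> complex" where
  "fun_scale c f = (\<lambda>_. c) * f"

global_interpretation fun_vs: vector_space "fun_scale :: complex \<Rightarrow> ('a \<Rightarrow> complex) \<Rightarrow> _"
  by unfold_locales (auto simp: fun_scale_def fun_eq_iff algebra_simps)

text \<open>Used twice: for the polynomials on \<open>V\<close> and for the invariants among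
  them.\<close>

locale function_algebra =
  fixes A :: "('a \<Rightarrow> complex) set"
  assumes const [simp, intro]: "(\<lambda>_. c) \<in> A"
    and add [intro]: "f \<in> A \<Longrightarrow> g \<in> A \<Longrightarrow> f + g \<in> A"
    and mult [intro]: "f \<in> A \<Longrightarrow> g \<in> A \<Longrightarrow> f * g \<in> A"
begin

lemma zero [simp, intro]: "0 \<in> A"
  and one [simp, intro]: "1 \<in> A"
  using const[of 0] const[of 1] by (simp_all add: zero_fun_def one_fun_def)

lemma uminus [intro]: "f \<in> A \<Longrightarrow> - f \<in> A"
  using mult[OF const[of "-1"]] by (simp add: fun_Compl_def times_fun_def)

lemma diff [intro]: "f \<in> A \<Longrightarrow> g \<in> A \<Longrightarrow> f - g \<in> A"
  using add[OF _ uminus, of f g] by simp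

lemma power [intro]: "f \<in> A \<Longrightarrow> f ^ n \<in> A"
  by (induction n) auto

lemma sum [intro]: "(\<And>i. i \<in> I \<Longrightarrow> f i \<in> A) \<Longrightarrow> sum f I \<in> A"
  by (induction I rule: infinite_finite_induct) auto

lemma prod [intro]: "(\<And>i. i \<in> I \<Longrightarrow> f i \<in> A) \<Longrightarrow> prod f I \<in> A"
  by (induction I rule: infinite_finite_induct) auto

text \<open>A record-free form of the library notion, which works directly on sets of functions;
  \<open>ideal_SR_iff\<close> connects the two.\<close>

definition is_ideal :: "('a \<Rightarrow> complex) set \<Rightarrow> bool" where
  "is_ideal I \<longleftrightarrow> I \<subseteq> A \<and> 0 \<in> I \<and> (\<forall>f\<in>I. \<forall>g\<in>I. f + g \<in> I) \<and> (\<forall>f\<in>A. \<forall>g\<in>I. f * g \<in> I)"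

lemma is_idealI:
  assumes "I \<subseteq> A" "0 \<in> I" "\<And>f g. f \<in> I \<Longrightarrow> g \<in> I \<Longrightarrow> f + g \<in> I"
    "\<And>f g. f \<in> A \<Longrightarrow> g \<in> I \<Longrightarrow> f * g \<in> I"
  shows "is_ideal I"
  using assms unfolding is_ideal_def by blast

lemma is_idealD:
  assumes "is_ideal I"
  shows "I \<subseteq> A" "0 \<in> I" "f \<in> I \<Longrightarrow> g \<in> I \<Longrightarrow> f + g \<in> I" "f \<in> A \<Longrightarrow> g \<in> I \<Longrightarrow> f * g \<in> I"
    "f \<in> A \<Longrightarrow> g \<in> I \<Longrightarrow> g * f \<in> I"
  using assms unfolding is_ideal_def by (auto simp: mult.commute)

lemma is_ideal_uminus: "is_ideal I \<Longrightarrow> f \<in> I \<Longrightarrow> - f \<in> I"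
  using is_idealD(4)[of I "- 1" f] uminus[of 1] by simp

lemma is_ideal_diff: "is_ideal I \<Longrightarrow> f \<in> I \<Longrightarrow> g \<in> I \<Longrightarrow> f - g \<in> I"
  using is_idealD(3)[of I f "- g"] is_ideal_uminus[of I g] by simp

lemma is_ideal_sum: "is_ideal I \<Longrightarrow> (\<And>i. i \<in> S \<Longrightarrow> f i \<in> I) \<Longrightarrow> sum f S \<in> I"
  by (induction S rule: infinite_finite_induct) (auto simp: is_idealD)

text \<open>Ideals without powers of \<open>a\<close> correspond to proper ideals of the
  localisation at \<open>a\<close>. The last conclusion says that \<open>f\<close> becomes
  invertible there modulo \<open>M\<close>, since \<open>y * f\<close> is congruent to the unit
  \<open>a ^ n\<close>. The localisation itself is never constructed.\<close>

lemma maximal_ideal_avoiding_powers: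
  assumes I: "is_ideal I" "\<And>n. a ^ n \<notin> I" and a: "a \<in> A"
  obtains M where "is_ideal M" "I \<subseteq> M" "\<And>n. a ^ n \<notin> M"
    "\<And>f. f \<in> A \<Longrightarrow> f \<notin> M \<Longrightarrow> \<exists>n. \<exists>y\<in>A. a ^ n - y * f \<in> M"
proof -
  let ?F = "{M. is_ideal M \<and> I \<subseteq> M \<and> (\<forall>n. a ^ n \<notin> M)}"
  have "\<exists>M\<in>?F. (\<forall>N\<in>?F. M \<subseteq> N \<longrightarrow> N = M)"
  proof (rule subset_Zorn_nonempty)
    show "?F \<noteq> {}" using I by blast
    fix \<C> assume ne: "\<C> \<noteq> {}" and ch: "subset.chain ?F \<C>"
    have mem: "\<And>C. C \<in> \<C> \<Longrightarrow> is_ideal C \<and> I \<subseteq> C \<and> (\<forall>n. a ^ n \<notin> C)"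
      using ch by (auto simp: subset_chain_def)
    have lin: "\<And>C C'. C \<in> \<C> \<Longrightarrow> C' \<in> \<C> \<Longrightarrow> C \<subseteq> C' \<or> C' \<subseteq> C"
      using ch by (auto simp: subset_chain_def)
    have "is_ideal (\<Union>\<C>)"
    proof (rule is_idealI)
      show "\<Union>\<C> \<subseteq> A" using mem is_idealD(1) by blast
      show "0 \<in> \<Union>\<C>" using mem is_idealD(2) ne by blast
      fix f g assume "f \<in> \<Union>\<C>" "g \<in> \<Union>\<C>"
      then obtain C C' where C: "C \<in> \<C>" "C' \<in> \<C>" "f \<in> C" "g \<in> C'" by blast
      then consider "f \<in> C'" | "g \<in> C" using lin by blast
      then show "f + g \<in> \<Union>\<C>" using C mem is_idealD(3) by cases blast+
    next
      fix f g assume "f \<in> A" "g \<in> \<Union>\<C>"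
      then show "f * g \<in> \<Union>\<C>" using mem is_idealD(4) by blast
    qed
    then show "\<Union>\<C> \<in> ?F" using mem ne by blast
  qed
  then obtain M where MF: "M \<in> ?F" and max: "\<forall>N\<in>?F. M \<subseteq> N \<longrightarrow> N = M" by (rule bexE)
  then have M: "is_ideal M" "I \<subseteq> M" "\<And>n. a ^ n \<notin> M" by auto
  have "\<exists>n. \<exists>y\<in>A. a ^ n - y * f \<in> M" if f: "f \<in> A" "f \<notin> M" for f
  proof -
    \<comment> \<open>The ideal generated by \<open>M\<close> and \<open>f\<close>; by maximality of
      \<open>M\<close> it contains a power of \<open>a\<close>.\<close>
    define J where "J = {m + y * f | m y. m \<in> M \<and> y \<in> A}"
    have "is_ideal J"
    proof (rule is_idealI)
      show "J \<subseteq> A" using is_idealD(1)[OF M(1)] f unfolding J_def by blast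
      show "0 \<in> J" unfolding J_def using is_idealD(2)[OF M(1)]
        by (intro CollectI exI[of _ 0]) simp
    next
      fix g h assume "g \<in> J" "h \<in> J"
      then obtain m y m' y' where *: "g = m + y * f" "h = m' + y' * f" "m \<in> M" "y \<in> A" "m' \<in> M" "y' \<in> A"
        unfolding J_def by blast
      have "g + h = (m + m') + (y + y') * f" unfolding * by (simp add: algebra_simps)
      then show "g + h \<in> J" unfolding J_def using * is_idealD(3)[OF M(1)] by blast
    next
      fix g h assume "g \<in> A" "h \<in> J"
      then obtain m y where *: "h = m + y * f" "m \<in> M" "y \<in> A" unfolding J_def by blast
      have "g * h = g * m + (g * y) * f" unfolding * by (simp add: algebra_simps)
      then show "g * h \<in> J" unfolding J_def using * \<open>g \<in> A\<close> is_idealD(4)[OF M(1)] by blast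
    qed
    moreover have MJ: "M \<subseteq> J"
    proof
      fix m assume "m \<in> M" then show "m \<in> J" unfolding J_def
        by (intro CollectI exI[of _ m] exI[of _ 0]) simp
    qed
    moreover have "f \<in> J" unfolding J_def using is_idealD(2)[OF M(1)]
      by (intro CollectI exI[of _ 0] exI[of _ 1]) simp
    ultimately have "J \<notin> ?F" using bspec[OF max, of J] f(2) by auto
    then obtain n where "a ^ n \<in> J" using \<open>is_ideal J\<close> MJ M(2) by auto
    then obtain m y where "a ^ n = m + y * f" "m \<in> M" "y \<in> A" unfolding J_def by blast
    then have "a ^ n - y * f \<in> M" by simp
    with \<open>y \<in> A\<close> show ?thesis by blast
  qed
  with M show ?thesis using that by blast
qed

lemma poly_comp_in:
  assumes "f \<in> A"
  shows "(\<lambda>x. poly q (f x)) \<in> A"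
proof (induction q)
  case (pCons c q)
  have "(\<lambda>x. poly (pCons c q) (f x)) = (\<lambda>_. c) + f * (\<lambda>x. poly q (f x))"
    by (auto simp: fun_eq_iff)
  then show ?case using pCons assms by auto
qed (use zero in \<open>simp add: zero_fun_def\<close>)

text \<open>
  The quotient by \<open>M\<close> of the localisation at \<open>a\<close> is a field of countable dimension, so the
  uncountably many inverses of \<open>f - c\<close> are linearly dependent, which makes \<open>f\<close> algebraic over the
  complex numbers.
\<close>

theorem exists_character:
  assumes E: "countable E" "A \<subseteq> fun_vs.span E"
    and I: "is_ideal I" "\<And>n. a ^ n \<notin> I" and a: "a \<in> A"
  obtains ev :: "('a \<Rightarrow> complex) \<Rightarrow> complex"
  where "\<And>c. ev (\<lambda>_. c) = c"
    "\<And>f g. f \<in> A \<Longrightarrow> g \<in> A \<Longrightarrow> ev (f + g) = ev f + ev g"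
    "\<And>f g. f \<in> A \<Longrightarrow> g \<in> A \<Longrightarrow> ev (f * g) = ev f * ev g"
    "\<And>f. f \<in> I \<Longrightarrow> ev f = 0" "ev a \<noteq> 0"
proof -
  obtain M where M: "is_ideal M" "I \<subseteq> M" "\<And>n. a ^ n \<notin> M"
    and max: "\<And>f. f \<in> A \<Longrightarrow> f \<notin> M \<Longrightarrow> \<exists>n. \<exists>y\<in>A. a ^ n - y * f \<in> M"
    using maximal_ideal_avoiding_powers[OF I a] by blast
  note MD = is_idealD[OF M(1)] is_ideal_diff[OF M(1)]
  have one: "1 \<notin> M" using M(3)[of 0] by simp
  have constM: "c = 0" if "(\<lambda>_. c) \<in> M" for c
  proof (rule ccontr)
    assume "c \<noteq> 0"
    then have "(\<lambda>_. inverse c) * (\<lambda>_. c) = (1 :: 'a \<Rightarrow> complex)" by (auto simp: fun_eq_iff)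
    then show False using MD(4)[OF const that, of "inverse c"] one by simp
  qed
  have prime: "g \<in> M" if fg: "f \<in> A" "g \<in> A" "f * g \<in> M" "f \<notin> M" for f g
  proof (rule ccontr)
    assume "g \<notin> M"
    then obtain n m y z where *: "y \<in> A" "z \<in> A" "a ^ n - y * f \<in> M" "a ^ m - z * g \<in> M"
      using max fg by meson
    \<comment> \<open>If neither factor were in \<open>M\<close>, both would divide a power of
      \<open>a\<close> modulo \<open>M\<close>; this telescoping identity shows that a power of
      \<open>a\<close> would then lie in \<open>M\<close>.\<close>
    have "a ^ (n + m) = a ^ m * (a ^ n - y * f) + (y * f) * (a ^ m - z * g) + (y * z) * (f * g)"
      by (simp add: algebra_simps power_add)
    also have "\<dots> \<in> M" by (intro MD(3) MD(4) power mult * fg a)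
    finally show False using M(3) by blast
  qed
  have val: "\<exists>c. f - (\<lambda>_. c) \<in> M" if f: "f \<in> A" for f
  proof (rule ccontr)
    assume "\<not> ?thesis"
    then have nM: "\<And>c. f - (\<lambda>_. c) \<notin> M" by blast
    \<comment> \<open>So \<open>f\<close> is transcendental modulo \<open>M\<close>: over the
      complex numbers \<open>q\<close> splits into linear factors, no \<open>f - d\<close> is in
      \<open>M\<close>, and primality removes the factors one by one.\<close>
    have polyM: "q = 0" if "(\<lambda>x. poly q (f x)) \<in> M" for q
      using that
    proof (induction "Polynomial.degree q" arbitrary: q rule: less_induct)
      case less
      show ?case
      proof (cases "Polynomial.degree q = 0")
        case True
        then obtain c where q: "q = [:c:]" using degree_eq_zeroE by blast
        with less.prems constM[of c] show ?thesis by simp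
      next
        case False
        then obtain d where "poly q d = 0"
          using fundamental_theorem_of_algebra[of q] constant_degree[of q] by auto
        then obtain r where r: "q = [:- d, 1:] * r" by (auto simp: poly_eq_0_iff_dvd)
        then have "r \<noteq> 0" using False by auto
        have "(\<lambda>x. poly q (f x)) = (f - (\<lambda>_. d)) * (\<lambda>x. poly r (f x))"
          unfolding r by (auto simp: fun_eq_iff algebra_simps)
        then have "(\<lambda>x. poly r (f x)) \<in> M"
          using prime[of "f - (\<lambda>_. d)" "\<lambda>x. poly r (f x)"] less.prems nM f poly_comp_in[OF f] by auto
        moreover have "Polynomial.degree r < Polynomial.degree q" unfolding r using \<open>r \<noteq> 0\<close>
          by (subst degree_mult_eq) auto
        ultimately show ?thesis using less.hyps \<open>r \<noteq> 0\<close> by blast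
      qed
    qed
    \<comment> \<open>The quotient \<open>y / a ^ n\<close> is the inverse of \<open>f - c\<close>
      in the localised residue ring. Numerator and exponent are tracked separately.\<close>
    have "\<forall>c. \<exists>n y. y \<in> A \<and> a ^ n - y * (f - (\<lambda>_. c)) \<in> M"
      using max nM f by blast
    then obtain N Y where Y: "\<And>c. Y c \<in> A" "\<And>c. a ^ (N c) - Y c * (f - (\<lambda>_. c)) \<in> M"
      by metis
    have "\<exists>t. finite t \<and> t \<subseteq> E \<and> Y c \<in> fun_vs.span t" for c
    proof -
      have "Y c \<in> fun_vs.span E" using E(2) Y(1) by blast
      then obtain t r where "finite t" "t \<subseteq> E" "Y c = (\<Sum>e\<in>t. fun_scale (r e) e)"
        unfolding fun_vs.span_explicit by blast
      then have "Y c \<in> fun_vs.span t"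
        by (simp add: fun_vs.span_sum fun_vs.span_scale fun_vs.span_base)
      then show ?thesis using \<open>finite t\<close> \<open>t \<subseteq> E\<close> by blast
    qed
    then obtain t where t: "\<And>c. finite (t c)" "\<And>c. t c \<subseteq> E" "\<And>c. Y c \<in> fun_vs.span (t c)"
      by metis
    \<comment> \<open>Pigeonhole: there are uncountably many \<open>c\<close>, but only countably
      many pairs of an exponent and a finite subset of \<open>E\<close>. Hence infinitely many
      \<open>c\<close> share a denominator \<open>a ^ n\<close> and a finite-dimensional space that
      contains the numerators.\<close>
    let ?Q = "UNIV \<times> {t. t \<subseteq> E \<and> finite t}"
    let ?S = "\<lambda>q :: nat \<times> ('a \<Rightarrow> complex) set. {c. N c = fst q \<and> t c = snd q}"
    have "\<exists>q\<in>?Q. infinite (?S q)"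
    proof (rule ccontr)
      assume "\<not> ?thesis"
      then have "countable (\<Union>q\<in>?Q. ?S q)"
        using countable_Collect_finite_subset[OF E(1)]
        by (intro countable_UN countable_SIGMA) (auto intro: countable_finite simp: conj_commute)
      moreover have "(\<Union>q\<in>?Q. ?S q) = UNIV" using t by auto
      ultimately show False using uncountable_UNIV_complex by simp
    qed
    then obtain n t0 where q: "finite t0" "infinite {c. N c = n \<and> t c = t0}" by auto
    define C where "C = {c. N c = n \<and> t c = t0}"
    have YC: "a ^ n - Y c * (f - (\<lambda>_. c)) \<in> M" if "c \<in> C" for c
      using Y(2)[of c] that by (simp add: C_def)
    \<comment> \<open>Dependence is a property of the set of numerators, so this set must be
      infinite. Equal numerators for \<open>c\<close> and \<open>d\<close> would put
      \<open>(c - d) * Y c\<close>, then \<open>Y c\<close>, and finally \<open>a ^ n\<close> into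
      \<open>M\<close>.\<close>
    have inj: "inj_on Y C"
    proof (rule inj_onI, rule ccontr)
      fix c d assume cd: "c \<in> C" "d \<in> C" "Y c = Y d" "c \<noteq> d"
      have "(\<lambda>_. c - d) * Y c = (a ^ n - Y c * (f - (\<lambda>_. c))) - (a ^ n - Y d * (f - (\<lambda>_. d))) "
        unfolding cd(3) by (auto simp: fun_eq_iff algebra_simps)
      also have "\<dots> \<in> M" by (rule MD(6)[OF YC[OF cd(1)] YC[OF cd(2)]])
      finally have "Y c \<in> M" using prime[OF const Y(1)] constM[of "c - d"] cd by auto
      then have "a ^ n - Y c * (f - (\<lambda>_. c)) + (f - (\<lambda>_. c)) * Y c \<in> M"
        using YC[OF cd(1)] f by (intro MD(3) MD(4)) auto
      then show False using M(3)[of n] by (simp add: mult.commute)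
    qed
    have "fun_vs.dependent (Y ` C)"
    proof (rule ccontr)
      assume "\<not> ?thesis"
      moreover have "Y ` C \<subseteq> fun_vs.span t0" using t(3) by (auto simp: C_def)
      ultimately have "finite (Y ` C)" using fun_vs.independent_span_bound[OF q(1)] by blast
      then show False using finite_imageD[OF _ inj] q(2) by (simp add: C_def)
    qed
    then obtain T u v where T: "finite T" "T \<subseteq> Y ` C" "(\<Sum>v\<in>T. (\<lambda>_. u v) * v) = 0" "v \<in> T" "u v \<noteq> 0"
      unfolding fun_vs.dependent_explicit fun_scale_def by blast
    then obtain D where D: "finite D" "D \<subseteq> C" "T = Y ` D"
      using finite_subset_image[OF T(1,2)] by blast
    define l where "l = u \<circ> Y"
    have injD: "inj_on Y D" using inj D(2) inj_on_subset by blast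
    have sum0: "(\<Sum>c\<in>D. (\<lambda>_. l c) * Y c) = 0"
      using T(3) unfolding D(3) by (simp add: sum.reindex[OF injD] l_def)
    obtain c0 where c0: "c0 \<in> D" "l c0 \<noteq> 0" using T(4,5) D(3) by (auto simp: l_def)
    \<comment> \<open>The numerator of the sum of the fractions \<open>l c / (X - c)\<close> over
      the common denominator. At \<open>c0\<close> only one summand survives, so its value is
      \<open>l c0\<close> times the product of the differences \<open>c0 - k\<close>, which is not
      zero.\<close>
    define q where "q = (\<Sum>c\<in>D. Polynomial.smult (l c) (\<Prod>k\<in>D - {c}. [:- k, 1:]))"
    let ?F = "\<lambda>c. (\<Prod>k\<in>D - {c}. f - (\<lambda>_. k))"
    have F: "?F c \<in> A" for c using f by auto
    have prod_app: "(\<Prod>k\<in>S. g k) x = (\<Prod>k\<in>S. g k x)" for S x and g :: "complex \<Rightarrow> 'a \<Rightarrow> complex"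
      by (induction S rule: infinite_finite_induct) auto
    have sum_app: "(\<Sum>k\<in>S. g k) x = (\<Sum>k\<in>S. g k x)" for S x and g :: "complex \<Rightarrow> 'a \<Rightarrow> complex"
      by (induction S rule: infinite_finite_induct) auto
    have qf: "(\<lambda>x. poly q (f x)) = (\<Sum>c\<in>D. (\<lambda>_. l c) * ?F c)"
      unfolding q_def by (auto simp: fun_eq_iff poly_sum poly_prod prod_app sum_app)
    have gen: "g * (r * h) = r * h * (g - y * z) + r * y * (z * h)" for g r h y z :: "'a \<Rightarrow> complex"
      by (simp add: algebra_simps)
    \<comment> \<open>Modulo \<open>M\<close>, each \<open>a ^ n\<close> is traded for
      \<open>Y c * (f - c)\<close>. This completes the product over \<open>D\<close>, which can be
      factored out of the linear relation.\<close>
    have "a ^ n * (\<lambda>x. poly q (f x)) =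
        (\<Sum>c\<in>D. (\<lambda>_. l c) * ?F c * (a ^ n - Y c * (f - (\<lambda>_. c)))) +
        (\<Sum>c\<in>D. (\<lambda>_. l c) * Y c * ((f - (\<lambda>_. c)) * ?F c))"
      unfolding qf sum_distrib_left sum.distrib[symmetric] by (intro sum.cong refl gen)
    also have "(\<Sum>c\<in>D. (\<lambda>_. l c) * Y c * ((f - (\<lambda>_. c)) * ?F c)) =
        (\<Sum>c\<in>D. (\<lambda>_. l c) * Y c * (\<Prod>k\<in>D. f - (\<lambda>_. k)))"
      by (intro sum.cong refl) (simp add: prod.remove[OF D(1)])
    also have "\<dots> = 0" unfolding sum_distrib_right[symmetric] sum0 by simp
    also have "(\<Sum>c\<in>D. (\<lambda>_. l c) * ?F c * (a ^ n - Y c * (f - (\<lambda>_. c)))) + 0 \<in> M"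
      unfolding add_0_right using D(2)
      by (intro is_ideal_sum[OF M(1)] MD(4) mult const F YC) blast
    finally have "a ^ n * (\<lambda>x. poly q (f x)) \<in> M" .
    then have "q = 0" using prime[OF power[OF a] poly_comp_in[OF f]] M(3) polyM by blast
    moreover have "poly q c0 = l c0 * (\<Prod>k\<in>D - {c0}. c0 - k)"
    proof -
      have "(\<Prod>k\<in>D - {c}. c0 - k) = 0" if "c \<in> D - {c0}" for c
        using that D(1) c0(1) by (intro prod_zero) auto
      then show ?thesis unfolding q_def
        by (simp add: poly_sum poly_prod sum.remove[OF D(1) c0(1)])
    qed
    ultimately show False using c0 D(1) by auto
  qed
  \<comment> \<open>Evaluation is the residue class modulo \<open>M\<close>: \<open>val\<close>
    gives a constant representative and \<open>constM\<close> makes it unique.\<close>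
  define ev where "ev f = (SOME c. f - (\<lambda>_. c) \<in> M)" for f
  have ev: "f - (\<lambda>_. ev f) \<in> M" if "f \<in> A" for f
    unfolding ev_def using someI_ex[OF val[OF that]] .
  have ev_eq: "ev f = c" if "f \<in> A" "f - (\<lambda>_. c) \<in> M" for f c
  proof -
    have "(f - (\<lambda>_. c)) - (f - (\<lambda>_. ev f)) \<in> M" using MD(6)[OF that(2) ev[OF that(1)]] .
    also have "(f - (\<lambda>_. c)) - (f - (\<lambda>_. ev f)) = (\<lambda>_. ev f - c)" by (auto simp: fun_eq_iff)
    finally show ?thesis using constM[of "ev f - c"] by simp
  qed
  show ?thesis
  proof (rule that[of ev])
    show "ev (\<lambda>_. c) = c" for c using MD(2) by (intro ev_eq) auto
    fix f g assume fg: "f \<in> A" "g \<in> A"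
    have "(f + g) - (\<lambda>_. ev f + ev g) = (f - (\<lambda>_. ev f)) + (g - (\<lambda>_. ev g))"
      by (auto simp: fun_eq_iff)
    also have "\<dots> \<in> M" by (intro MD(3) ev fg)
    finally show "ev (f + g) = ev f + ev g" by (intro ev_eq add fg)
    have "f * g - (\<lambda>_. ev f * ev g) = g * (f - (\<lambda>_. ev f)) + (\<lambda>_. ev f) * (g - (\<lambda>_. ev g))"
      by (auto simp: fun_eq_iff algebra_simps)
    also have "\<dots> \<in> M" by (intro MD(3,4) ev fg const)
    finally show "ev (f * g) = ev f * ev g" by (intro ev_eq mult fg)
  next
    fix f assume "f \<in> I"
    then have "f - (\<lambda>_. 0) \<in> M" using M(2) by (auto simp: zero_fun_def[symmetric])
    then show "ev f = 0" using \<open>f \<in> I\<close> M(2) MD(1) by (intro ev_eq) auto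
  next
    show "ev a \<noteq> 0"
    proof
      assume "ev a = 0"
      then have "a \<in> M" using ev[OF a] by (simp add: zero_fun_def[symmetric])
      then show False using M(3)[of 1] by simp
    qed
  qed
qed

end

section \<open>Polynomial functions\<close>

text \<open>The spanning condition passes to subalgebras and so makes
  \<open>exists_character\<close> available for the invariants. The second axiom is the weak
  Nullstellensatz, with zeros among the points of the given space.\<close>

locale affine_algebra = function_algebra +
  assumes countable_span: "\<exists>E. countable E \<and> A \<subseteq> fun_vs.span E"
    and nullstellensatz: "is_ideal J \<Longrightarrow> 1 \<notin> J \<Longrightarrow> \<exists>y. \<forall>f\<in>J. f y = 0"

lemma function_algebra_polynomial_functions: "function_algebra (polynomial_functions s)"
  by unfold_locales
    (auto simp: polynomial_functions_def plus_fun_def times_fun_def intro: fun_algebra.intros)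

context finite_dimensional_vector_space
begin

definition coords :: "('b \<Rightarrow> 'a) set" where
  "coords = (\<lambda>b v. representation Basis v b) ` Basis"

lemma linear_functional_eq_sum:
  assumes "Vector_Spaces.linear scale (*) l"
  shows "l v = (\<Sum>b\<in>Basis. l b * representation Basis v b)"
proof -
  interpret l: Vector_Spaces.linear scale "(*)" l by fact
  have "l v = l (\<Sum>b\<in>Basis. scale (representation Basis v b) b)"
    using sum_representation_eq[OF independent_Basis _ finite_Basis subset_refl, of v]
    by (simp add: span_Basis)
  then show ?thesis by (simp add: l.sum l.scale mult.commute)
qed

lemma linear_representation_Basis: "Vector_Spaces.linear scale (*) (\<lambda>v. representation Basis v b)"
  using linear_representation[OF independent_Basis span_Basis] .

lemma representation_sum_Basis:
  assumes "b \<in> Basis"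
  shows "representation Basis (\<Sum>b\<in>Basis. scale (u b) b) b = u b"
proof -
  interpret r: Vector_Spaces.linear scale "(*)" "\<lambda>v. representation Basis v b"
    by (rule linear_representation_Basis)
  have "representation Basis (\<Sum>b\<in>Basis. scale (u b) b) b
      = (\<Sum>c\<in>Basis. u c * (if c = b then 1 else 0))"
    unfolding r.sum r.scale
    by (intro sum.cong refl) (auto simp: representation_basis[OF independent_Basis])
  then show ?thesis using assms finite_Basis by (simp add: if_distrib cong: if_cong)
qed

end

lemma span_mult_closed:
  fixes E :: "('a \<Rightarrow> complex) set"
  assumes E: "\<And>f g. f \<in> E \<Longrightarrow> g \<in> E \<Longrightarrow> f * g \<in> E"
    and f: "f \<in> fun_vs.span E" and g: "g \<in> fun_vs.span E"
  shows "f * g \<in> fun_vs.span E"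
proof -
  have 1: "f * g \<in> fun_vs.span E" if "f \<in> E" "g \<in> fun_vs.span E" for f g
    using that(2)
  proof (induction rule: fun_vs.span_induct_alt)
    case base
    then show ?case using fun_vs.span_zero[of E] by (simp add: zero_fun_def)
  next
    case (step c h g)
    have "f * (fun_scale c h + g) = fun_scale c (f * h) + f * g"
      by (auto simp: fun_scale_def fun_eq_iff algebra_simps)
    then show ?case
      using step E[OF that(1)] by (simp only: fun_vs.span_add fun_vs.span_scale fun_vs.span_base)
  qed
  from f show ?thesis
  proof (induction rule: fun_vs.span_induct_alt)
    case base
    then show ?case using fun_vs.span_zero[of E] by (simp add: zero_fun_def)
  next
    case (step c h k)
    have "(fun_scale c h + k) * g = fun_scale c (h * g) + k * g"
      by (auto simp: fun_scale_def fun_eq_iff algebra_simps)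
    then show ?case
      using step 1[OF _ g] by (simp only: fun_vs.span_add fun_vs.span_scale)
  qed
qed

text \<open>The spanning set consists of the monomials, as products of lists of coordinate
  functionals; a finite basis has only countably many such lists.\<close>

lemma polynomial_functions_countable_span:
  assumes "finite_dimensional_vector_space s B"
  shows "\<exists>E. countable E \<and> polynomial_functions s \<subseteq> fun_vs.span E"
proof -
  interpret finite_dimensional_vector_space s B by fact
  define E where "E = prod_list ` lists coords"
  have E_mult: "f * g \<in> E" if fg: "f \<in> E" "g \<in> E" for f g
  proof -
    obtain xs ys where "f = prod_list xs" "g = prod_list ys" "xs \<in> lists coords" "ys \<in> lists coords"
      using fg unfolding E_def by blast
    then have "f * g = prod_list (xs @ ys)" "xs @ ys \<in> lists coords" by simp_all
    then show ?thesis unfolding E_def by blast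
  qed
  have E_one: "1 \<in> E" unfolding E_def by (intro image_eqI[of _ _ "[]"]) auto
  have E_coord: "l \<in> E" if "l \<in> coords" for l
    unfolding E_def using that by (intro image_eqI[of _ _ "[l]"]) auto
  have "f \<in> fun_vs.span E" if "f \<in> polynomial_functions s" for f
    using that unfolding polynomial_functions_def
  proof (induction rule: fun_algebra.induct)
    case (const c)
    have "(\<lambda>_. c) = fun_scale c 1" by (auto simp: fun_scale_def fun_eq_iff)
    also have "\<dots> \<in> fun_vs.span E"
      by (intro fun_vs.span_scale fun_vs.span_base E_one)
    finally show ?case .
  next
    case (gen l)
    have sum_app: "(\<Sum>k\<in>S. g k) x = (\<Sum>k\<in>S. g k x)" for S x and g :: "'a \<Rightarrow> 'a \<Rightarrow> complex"
      by (induction S rule: infinite_finite_induct) auto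
    have "l = (\<Sum>b\<in>B. fun_scale (l b) (\<lambda>v. representation B v b))"
    proof
      fix v
      show "l v = (\<Sum>b\<in>B. fun_scale (l b) (\<lambda>v. representation B v b)) v"
        using linear_functional_eq_sum[of l v] gen by (simp add: sum_app fun_scale_def)
    qed
    also have "\<dots> \<in> fun_vs.span E"
      by (intro fun_vs.span_sum fun_vs.span_scale fun_vs.span_base E_coord) (simp add: coords_def)
    finally show ?case .
  next
    case (add f g)
    then show ?case using fun_vs.span_add[of f E g] by (simp add: plus_fun_def)
  next
    case (mult f g)
    then show ?case using span_mult_closed[of E f g] E_mult by (simp add: times_fun_def)
  qed
  moreover have "countable E"
    unfolding E_def coords_def by (intro countable_image countable_lists countable_finite finite_imageI finite_Basis)
  ultimately show ?thesis by blast
qed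

text \<open>A proper ideal is killed by a character, by \<open>exists_character\<close> with
  \<open>a = 1\<close>. A character of the polynomial ring is evaluation at the vector whose
  coordinates are its values on the coordinate functionals.\<close>

lemma affine_algebra_polynomial_functions:
  assumes "finite_dimensional_vector_space s B"
  shows "affine_algebra (polynomial_functions s)"
proof -
  interpret finite_dimensional_vector_space s B by fact
  interpret function_algebra "polynomial_functions s"
    by (rule function_algebra_polynomial_functions)
  show ?thesis
  proof unfold_locales
    show ex: "\<exists>E. countable E \<and> polynomial_functions s \<subseteq> fun_vs.span E"
      by (rule polynomial_functions_countable_span) fact
    fix J assume J: "is_ideal J" "1 \<notin> J"
    obtain E where E: "countable E" "polynomial_functions s \<subseteq> fun_vs.span E" using ex by blast
    obtain ev where ev: "\<And>c. ev (\<lambda>_. c) = c"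
      "\<And>f g. f \<in> polynomial_functions s \<Longrightarrow> g \<in> polynomial_functions s \<Longrightarrow> ev (f + g) = ev f + ev g"
      "\<And>f g. f \<in> polynomial_functions s \<Longrightarrow> g \<in> polynomial_functions s \<Longrightarrow> ev (f * g) = ev f * ev g"
      "\<And>f. f \<in> J \<Longrightarrow> ev f = 0"
      by (rule exists_character[OF E J(1), of 1]) (use J(2) in auto)
    have lin: "l \<in> polynomial_functions s" if "Vector_Spaces.linear s (*) l" for l
      using that unfolding polynomial_functions_def by (intro fun_algebra.gen) simp
    have ev_sum: "ev (\<Sum>i\<in>S. f i) = (\<Sum>i\<in>S. ev (f i))"
      if "\<And>i. i \<in> S \<Longrightarrow> f i \<in> polynomial_functions s" for S :: "'a set" and f
      using that
      by (induction S rule: infinite_finite_induct)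
        (use ev(1)[of 0] in \<open>auto simp: ev(2) sum zero_fun_def\<close>)
    define y where "y = (\<Sum>b\<in>B. s (ev (\<lambda>v. representation B v b)) b)"
    have "ev f = f y" if "f \<in> polynomial_functions s" for f
      using that unfolding polynomial_functions_def
    proof (induction rule: fun_algebra.induct)
      case (gen l)
      then have l: "Vector_Spaces.linear s (*) l" by simp
      have sum_app: "(\<Sum>k\<in>S. g k) x = (\<Sum>k\<in>S. g k x)" for S x and g :: "'a \<Rightarrow> 'a \<Rightarrow> complex"
        by (induction S rule: infinite_finite_induct) auto
      have "l = (\<Sum>b\<in>B. (\<lambda>_. l b) * (\<lambda>v. representation B v b))"
      proof
        fix v
        show "l v = (\<Sum>b\<in>B. (\<lambda>_. l b) * (\<lambda>v. representation B v b)) v"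
          using linear_functional_eq_sum[OF l, of v] by (simp add: sum_app)
      qed
      then have "ev l = ev (\<Sum>b\<in>B. (\<lambda>_. l b) * (\<lambda>v. representation B v b))" by (rule arg_cong)
      also have "\<dots> = (\<Sum>b\<in>B. l b * ev (\<lambda>v. representation B v b))"
        using lin[OF linear_representation_Basis]
        by (subst ev_sum) (auto simp: ev(1,3) mult const simp del: times_fun_apply intro!: sum.cong)
      also have "\<dots> = (\<Sum>b\<in>B. l b * representation B y b)"
        unfolding y_def by (intro sum.cong refl) (simp add: representation_sum_Basis)
      also have "\<dots> = l y" by (rule linear_functional_eq_sum[OF l, symmetric])
      finally show ?case .
    next
      case (add f g)
      then show ?case using ev(2)[of f g] by (simp add: polynomial_functions_def plus_fun_def)
    next
      case (mult f g)
      then show ?case using ev(3)[of f g] by (simp add: polynomial_functions_def times_fun_def)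
    qed (rule ev(1))
    then show "\<exists>y. \<forall>f\<in>J. f y = 0" using ev(4) is_idealD(1)[OF J(1)] by (intro exI[of _ y]) force
  qed
qed

section \<open>Zariski topologies\<close>

context function_algebra
begin

lemma topspace_zariski [simp]: "topspace (zariski_topology A) = UNIV"
proof -
  have "UNIV = {x. (1 :: 'a \<Rightarrow> complex) x \<noteq> 0}" by simp
  then have "UNIV \<in> {{x. f x \<noteq> 0} | f. f \<in> A}" using one by blast
  then show ?thesis unfolding zariski_topology_def topology_generated_by_topspace by blast
qed

lemma openin_nonzeros: "f \<in> A \<Longrightarrow> openin (zariski_topology A) {x. f x \<noteq> 0}"
  unfolding zariski_topology_def by (intro topology_generated_by_Basis) blast

lemma openin_zariskiD:
  assumes "openin (zariski_topology A) U" "x \<in> U"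
  obtains f where "f \<in> A" "f x \<noteq> 0" "\<forall>y. f y \<noteq> 0 \<longrightarrow> y \<in> U"
proof -
  have "b \<inter> c \<in> {{x. f x \<noteq> 0} | f. f \<in> A}"
    if bc: "b \<in> {{x. f x \<noteq> 0} | f. f \<in> A}" "c \<in> {{x. f x \<noteq> 0} | f. f \<in> A}" for b c
  proof -
    obtain f g where fg: "b = {x. f x \<noteq> 0}" "c = {x. g x \<noteq> 0}" "f \<in> A" "g \<in> A" using bc by blast
    have "b \<inter> c = {x. (f * g) x \<noteq> 0}" unfolding fg by auto
    then show ?thesis using mult[OF fg(3,4)] by (intro CollectI exI[of _ "f * g"] conjI)
  qed
  then obtain b where "b \<in> {{x. f x \<noteq> 0} | f. f \<in> A}" "x \<in> b" "b \<subseteq> U"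
    by (rule openin_basis_refinement[OF assms[unfolded zariski_topology_def]])
  then show ?thesis using that by blast
qed

lemma closedin_zeros:
  assumes "f \<in> A" shows "closedin (zariski_topology A) {x. f x = 0}"
proof -
  have "UNIV - {x. f x = 0} = {x. f x \<noteq> 0}" by auto
  then show ?thesis using openin_nonzeros[OF assms] by (simp add: closedin_def)
qed

lemma closedin_zariskiD:
  assumes "closedin (zariski_topology A) C" "x \<notin> C"
  obtains f where "f \<in> A" "f x \<noteq> 0" "\<forall>y\<in>C. f y = 0"
proof -
  have 1: "openin (zariski_topology A) (UNIV - C)" using assms(1) by (simp add: closedin_def)
  have 2: "x \<in> UNIV - C" using assms(2) by simp
  obtain f where f: "f \<in> A" "f x \<noteq> 0" "\<forall>y. f y \<noteq> 0 \<longrightarrow> y \<in> UNIV - C"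
    using openin_zariskiD[OF 1 2] by blast
  show ?thesis by (rule that[OF f(1,2)]) (use f(3) in blast)
qed

lemma openin_subtopology_zariskiD:
  assumes "openin (subtopology (zariski_topology A) Y) U" "x \<in> U"
  obtains f where "f \<in> A" "f x \<noteq> 0" "\<forall>y\<in>Y. f y \<noteq> 0 \<longrightarrow> y \<in> U"
proof -
  obtain O' where O': "openin (zariski_topology A) O'" "U = O' \<inter> Y"
    using assms(1) by (auto simp: openin_subtopology)
  have x: "x \<in> O'" using O'(2) assms(2) by simp
  obtain f where f: "f \<in> A" "f x \<noteq> 0" "\<forall>y. f y \<noteq> 0 \<longrightarrow> y \<in> O'"
    using openin_zariskiD[OF O'(1) x] by blast
  show ?thesis by (rule that[OF f(1,2)]) (use f(3) O'(2) in blast)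
qed

lemma irreducible_subset_UNIV_zariski:
  assumes "\<And>f g. f \<in> A \<Longrightarrow> g \<in> A \<Longrightarrow> f * g = 0 \<Longrightarrow> f = 0 \<or> g = 0"
  shows "irreducible_subset (zariski_topology A) UNIV"
  unfolding irreducible_subset_def
proof (intro conjI allI impI)
  fix C D assume CD: "closedin (zariski_topology A) C \<and> closedin (zariski_topology A) D \<and> UNIV \<subseteq> C \<union> D"
  show "UNIV \<subseteq> C \<or> UNIV \<subseteq> D"
  proof (rule ccontr)
    assume "\<not> ?thesis"
    then obtain x y where "x \<notin> C" "y \<notin> D" by blast
    obtain f where f: "f \<in> A" "f x \<noteq> 0" "\<forall>z\<in>C. f z = 0"
      using closedin_zariskiD[of C x] CD \<open>x \<notin> C\<close> by blast
    obtain g where g: "g \<in> A" "g y \<noteq> 0" "\<forall>z\<in>D. g z = 0"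
      using closedin_zariskiD[of D y] CD \<open>y \<notin> D\<close> by blast
    have "f * g = 0"
    proof
      fix z have "z \<in> C \<or> z \<in> D" using CD by blast
      then show "(f * g) z = 0 z" using f(3) g(3) by auto
    qed
    then show False using assms[OF f(1) g(1)] f(2) g(2) by auto
  qed
qed auto

end

lemma polynomial_function_on_line:
  assumes "vector_space s" "f \<in> polynomial_functions s"
  shows "\<exists>p. \<forall>t. f (u + s t v) = poly p t"
  using assms(2) unfolding polynomial_functions_def
proof (induction rule: fun_algebra.induct)
  case (const c)
  then show ?case by (intro exI[of _ "[:c:]"]) simp
next
  case (gen l)
  then interpret l: Vector_Spaces.linear s "(*)" l by simp
  show ?case by (intro exI[of _ "[:l u, l v:]"]) (simp add: l.add l.scale)
next
  case (add f g)
  then obtain p q where "\<forall>t. f (u + s t v) = poly p t" "\<forall>t. g (u + s t v) = poly q t" by blast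
  then show ?case by (intro exI[of _ "p + q"]) simp
next
  case (mult f g)
  then obtain p q where "\<forall>t. f (u + s t v) = poly p t" "\<forall>t. g (u + s t v) = poly q t" by blast
  then show ?case by (intro exI[of _ "p * q"]) simp
qed

text \<open>On the line through a point with \<open>f u \<noteq> 0\<close> (parameter 0) and a point
  with \<open>g w \<noteq> 0\<close> (parameter 1), both restrict to nonzero polynomials in one
  variable, whose product would vanish at every parameter.\<close>

lemma polynomial_functions_integral:
  assumes s: "vector_space s" and fg: "f \<in> polynomial_functions s" "g \<in> polynomial_functions s" "f * g = 0"
  shows "f = 0 \<or> g = 0"
proof (rule ccontr)
  assume "\<not> ?thesis"
  then obtain u w where "f u \<noteq> 0" "g w \<noteq> 0" by (auto simp: fun_eq_iff)
  define v where "v = w - u"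
  interpret vector_space s by fact
  obtain p q where p: "\<And>t. f (u + s t v) = poly p t" and q: "\<And>t. g (u + s t v) = poly q t"
    using polynomial_function_on_line[OF s] fg(1,2) by metis
  have "poly p 0 \<noteq> 0" "poly q 1 \<noteq> 0"
    using p[of 0] q[of 1] \<open>f u \<noteq> 0\<close> \<open>g w \<noteq> 0\<close> by (simp_all add: v_def)
  moreover have "poly (p * q) t = 0" for t
    using fun_cong[OF fg(3), of "u + s t v"] p q by simp
  then have "p * q = 0" using poly_all_0_iff_0 by blast
  ultimately show False by auto
qed

lemma irreducible_subset_UNIV_polynomial_functions:
  assumes "vector_space s"
  shows "irreducible_subset (zariski_topology (polynomial_functions s)) UNIV"
proof -
  interpret function_algebra "polynomial_functions s"
    by (rule function_algebra_polynomial_functions)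
  show ?thesis
    by (rule irreducible_subset_UNIV_zariski) (rule polynomial_functions_integral[OF assms])
qed

section \<open>Fraction fields\<close>

text \<open>The operations of \<open>fraction_field\<close> are unions over representatives; such a
  union collapses to one class once independence of the representatives is known.\<close>

lemma UN_pairs_constant:
  assumes "p \<in> P" "q \<in> Q" "\<And>x y z w. (x, y) \<in> P \<Longrightarrow> (z, w) \<in> Q \<Longrightarrow> F x y z w = C"
  shows "(\<Union>(x, y)\<in>P. \<Union>(z, w)\<in>Q. F x y z w) = C"
proof -
  have "(\<Union>(x, y)\<in>P. \<Union>(z, w)\<in>Q. F x y z w) = (\<Union>p\<in>P. \<Union>q\<in>Q. C)"
    by (intro SUP_cong refl) (auto simp: assms(3))
  then show ?thesis using assms(1,2) by auto
qed

context domain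
begin

lemma fraction_eq_iff:
  assumes "a \<in> carrier R" "b \<in> carrier R - {\<zero>}" "c \<in> carrier R" "d \<in> carrier R - {\<zero>}"
  shows "fraction R a b = fraction R c d \<longleftrightarrow> a \<otimes> d = c \<otimes> b"
proof
  assume "fraction R a b = fraction R c d"
  moreover have "(a, b) \<in> fraction R a b" using assms by (simp add: fraction_def)
  ultimately have "c \<otimes> b = a \<otimes> d" by (simp add: fraction_def)
  then show "a \<otimes> d = c \<otimes> b" by simp
next
  assume eq: "a \<otimes> d = c \<otimes> b"
  have "a \<otimes> y = x \<otimes> b \<longleftrightarrow> c \<otimes> y = x \<otimes> d" if xy: "x \<in> carrier R" "y \<in> carrier R - {\<zero>}" for x y
  proof -
    have "a \<otimes> y = x \<otimes> b \<longleftrightarrow> d \<otimes> (a \<otimes> y) = d \<otimes> (x \<otimes> b)"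
      using assms xy by (simp add: m_lcancel)
    also have "d \<otimes> (a \<otimes> y) = b \<otimes> (c \<otimes> y)"
    proof -
      have "d \<otimes> (a \<otimes> y) = (a \<otimes> d) \<otimes> y" using assms xy by (simp add: m_ac)
      then show ?thesis unfolding eq using assms xy by (simp add: m_ac)
    qed
    also have "d \<otimes> (x \<otimes> b) = b \<otimes> (x \<otimes> d)" using assms xy by (simp add: m_ac)
    finally show ?thesis using assms xy by (simp add: m_lcancel)
  qed
  then show "fraction R a b = fraction R c d" unfolding fraction_def by blast
qed

lemma fraction_memE:
  assumes "(x, y) \<in> fraction R a b" "a \<in> carrier R" "b \<in> carrier R - {\<zero>}"
  shows "x \<in> carrier R" "y \<in> carrier R - {\<zero>}" "fraction R x y = fraction R a b"
proof -
  show 1: "x \<in> carrier R" "y \<in> carrier R - {\<zero>}" using assms(1) by (auto simp: fraction_def)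
  have "a \<otimes> y = x \<otimes> b" using assms(1) by (auto simp: fraction_def)
  then show "fraction R x y = fraction R a b" using fraction_eq_iff[OF 1 assms(2,3)] by simp
qed

lemma fraction_self_mem:
  "a \<in> carrier R \<Longrightarrow> b \<in> carrier R - {\<zero>} \<Longrightarrow> (a, b) \<in> fraction R a b"
  by (simp add: fraction_def)

lemma fraction_mult:
  assumes "a \<in> carrier R" "b \<in> carrier R - {\<zero>}" "c \<in> carrier R" "d \<in> carrier R - {\<zero>}"
  shows "fraction R a b \<otimes>\<^bsub>fraction_field R\<^esub> fraction R c d = fraction R (a \<otimes> c) (b \<otimes> d)"
proof -
  have "fraction R (x \<otimes> z) (y \<otimes> w) = fraction R (a \<otimes> c) (b \<otimes> d)"
    if xy: "(x, y) \<in> fraction R a b" and zw: "(z, w) \<in> fraction R c d" for x y z w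
  proof -
    have 1: "x \<in> carrier R" "y \<in> carrier R - {\<zero>}" "z \<in> carrier R" "w \<in> carrier R - {\<zero>}"
      "a \<otimes> y = x \<otimes> b" "c \<otimes> w = z \<otimes> d"
      using xy zw by (auto simp: fraction_def)
    have "(x \<otimes> z) \<otimes> (b \<otimes> d) = (x \<otimes> b) \<otimes> (z \<otimes> d)" using assms 1(1-4) by (simp add: m_ac)
    also have "\<dots> = (a \<otimes> c) \<otimes> (y \<otimes> w)" unfolding 1(5,6)[symmetric] using assms 1(1-4) by (simp add: m_ac)
    finally show ?thesis using assms 1 by (subst fraction_eq_iff) (auto simp: integral_iff)
  qed
  from UN_pairs_constant[OF fraction_self_mem[OF assms(1,2)] fraction_self_mem[OF assms(3,4)] this]
  show ?thesis by (simp add: fraction_field_def)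
qed

lemma fraction_add:
  assumes "a \<in> carrier R" "b \<in> carrier R - {\<zero>}" "c \<in> carrier R" "d \<in> carrier R - {\<zero>}"
  shows "fraction R a b \<oplus>\<^bsub>fraction_field R\<^esub> fraction R c d
    = fraction R (a \<otimes> d \<oplus> c \<otimes> b) (b \<otimes> d)"
proof -
  have "fraction R (x \<otimes> w \<oplus> z \<otimes> y) (y \<otimes> w) = fraction R (a \<otimes> d \<oplus> c \<otimes> b) (b \<otimes> d)"
    if xy: "(x, y) \<in> fraction R a b" and zw: "(z, w) \<in> fraction R c d" for x y z w
  proof -
    have 1: "x \<in> carrier R" "y \<in> carrier R - {\<zero>}" "z \<in> carrier R" "w \<in> carrier R - {\<zero>}"
      "a \<otimes> y = x \<otimes> b" "c \<otimes> w = z \<otimes> d"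
      using xy zw by (auto simp: fraction_def)
    have "(x \<otimes> w \<oplus> z \<otimes> y) \<otimes> (b \<otimes> d) = (x \<otimes> b) \<otimes> (w \<otimes> d) \<oplus> (z \<otimes> d) \<otimes> (y \<otimes> b)"
      using assms 1(1-4) by (simp add: m_ac l_distr r_distr)
    also have "\<dots> = (a \<otimes> d \<oplus> c \<otimes> b) \<otimes> (y \<otimes> w)"
      unfolding 1(5,6)[symmetric] using assms 1(1-4) by (simp add: m_ac l_distr r_distr)
    finally show ?thesis using assms 1 by (subst fraction_eq_iff) (auto simp: integral_iff)
  qed
  from UN_pairs_constant[OF fraction_self_mem[OF assms(1,2)] fraction_self_mem[OF assms(3,4)] this]
  show ?thesis by (simp add: fraction_field_def)
qed

lemma fraction_in_carrier:
  "a \<in> carrier R \<Longrightarrow> b \<in> carrier R - {\<zero>} \<Longrightarrow> fraction R a b \<in> carrier (fraction_field R)"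
  by (auto simp: fraction_field_def)

lemma as_fraction_ring_hom: "as_fraction R \<in> ring_hom R (fraction_field R)"
proof (rule ring_hom_memI)
  fix a b assume "a \<in> carrier R" "b \<in> carrier R"
  then show "as_fraction R (a \<otimes> b) = as_fraction R a \<otimes>\<^bsub>fraction_field R\<^esub> as_fraction R b"
    "as_fraction R (a \<oplus> b) = as_fraction R a \<oplus>\<^bsub>fraction_field R\<^esub> as_fraction R b"
    by (simp_all add: as_fraction_def fraction_mult fraction_add)
qed (simp_all add: as_fraction_def fraction_in_carrier, simp add: fraction_field_def)

lemma as_fraction_eq_iff:
  "a \<in> carrier R \<Longrightarrow> b \<in> carrier R \<Longrightarrow> as_fraction R a = as_fraction R b \<longleftrightarrow> a = b"
  by (simp add: as_fraction_def fraction_eq_iff)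

text \<open>The image of a nonzero \<open>a\<close> has an inverse, namely the image of
  \<open>1 / a\<close>, and is therefore nonzero. The argument needs only this product, not a field
  instance for the fractions.\<close>

lemma fraction_field_hom_inj:
  assumes K: "field K" and h: "h \<in> ring_hom (fraction_field R) K"
  shows "inj_on (h \<circ> as_fraction R) (carrier R)"
proof -
  interpret K: field K by fact
  have hom: "h \<circ> as_fraction R \<in> ring_hom R K"
    using ring_hom_trans[OF as_fraction_ring_hom h] .
  interpret H: ring_hom_cring R K "h \<circ> as_fraction R"
    by (intro ring_hom_cringI hom is_cring K.is_cring)
  have "h (as_fraction R a) \<noteq> \<zero>\<^bsub>K\<^esub>" if a: "a \<in> carrier R" "a \<noteq> \<zero>" for a
  proof
    assume "h (as_fraction R a) = \<zero>\<^bsub>K\<^esub>"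
    moreover have "as_fraction R a \<otimes>\<^bsub>fraction_field R\<^esub> fraction R \<one> a = as_fraction R \<one>"
      using a by (simp add: as_fraction_def fraction_mult fraction_eq_iff)
    then have "h (as_fraction R a) \<otimes>\<^bsub>K\<^esub> h (fraction R \<one> a) = h (as_fraction R \<one>)"
      using ring_hom_mult[OF h, of "as_fraction R a" "fraction R \<one> a"] a
      by (simp add: as_fraction_def fraction_in_carrier)
    moreover have "h (fraction R \<one> a) \<in> carrier K"
      using ring_hom_closed[OF h, of "fraction R \<one> a"] a by (simp add: fraction_in_carrier)
    ultimately show False using H.hom_one by simp
  qed
  note nonzero = this
  show ?thesis
  proof (rule inj_onI)
    fix a b assume ab: "a \<in> carrier R" "b \<in> carrier R" "(h \<circ> as_fraction R) a = (h \<circ> as_fraction R) b"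
    have "(h \<circ> as_fraction R) (a \<ominus> b) = \<zero>\<^bsub>K\<^esub>"
      unfolding a_minus_def using ab by (simp del: comp_apply add: H.hom_add H.hom_a_inv K.r_neg)
    then have "a \<ominus> b = \<zero>" using nonzero[of "a \<ominus> b"] ab by auto
    then show "a = b" using ab by simp
  qed
qed

end

section \<open>Irreducible varieties\<close>

locale irreducible_variety = function_algebra +
  fixes Y
  assumes irreducible: "irreducible_subset (zariski_topology A) Y"
begin

lemma Y_nonempty: "Y \<noteq> {}"
  using irreducible unfolding irreducible_subset_def by blast

lemma integral:
  assumes fg: "f \<in> A" "g \<in> A" "\<forall>x\<in>Y. f x * g x = 0"
  shows "(\<forall>x\<in>Y. f x = 0) \<or> (\<forall>x\<in>Y. g x = 0)"
proof -
  have "Y \<subseteq> {x. f x = 0} \<union> {x. g x = 0}" using fg(3) by auto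
  then have "Y \<subseteq> {x. f x = 0} \<or> Y \<subseteq> {x. g x = 0}"
    using irreducible closedin_zeros fg(1,2) unfolding irreducible_subset_def by blast
  then show ?thesis by blast
qed

lemma open_subsets_meet:
  assumes U: "openin (subtopology (zariski_topology A) Y) U" "U \<noteq> {}"
    and U': "openin (subtopology (zariski_topology A) Y) U'" "U' \<noteq> {}"
  shows "U \<inter> U' \<noteq> {}"
proof -
  obtain u u' where u: "u \<in> U" "u' \<in> U'" using U(2) U'(2) by blast
  obtain f where f: "f \<in> A" "f u \<noteq> 0" "\<forall>y\<in>Y. f y \<noteq> 0 \<longrightarrow> y \<in> U"
    using openin_subtopology_zariskiD[OF U(1) u(1)] by blast
  obtain g where g: "g \<in> A" "g u' \<noteq> 0" "\<forall>y\<in>Y. g y \<noteq> 0 \<longrightarrow> y \<in> U'"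
    using openin_subtopology_zariskiD[OF U'(1) u(2)] by blast
  have "u \<in> Y" "u' \<in> Y" using u openin_subset[OF U(1)] openin_subset[OF U'(1)] by auto
  then have "\<not> (\<forall>x\<in>Y. f x * g x = 0)" using integral[OF f(1) g(1)] f(2) g(2) by blast
  then show ?thesis using f(3) g(3) by fastforce
qed

lemma eq_if_eq_on_open:
  assumes U: "openin (subtopology (zariski_topology A) Y) U" "U \<noteq> {}"
    and fg: "f \<in> A" "g \<in> A" "\<forall>x\<in>U. f x = g x" and x: "x \<in> Y"
  shows "f x = g x"
proof -
  obtain u where u: "u \<in> U" using U(2) by blast
  obtain h where h: "h \<in> A" "h u \<noteq> 0" "\<forall>y\<in>Y. h y \<noteq> 0 \<longrightarrow> y \<in> U"
    using openin_subtopology_zariskiD[OF U(1) u] by blast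
  have "u \<in> Y" using u openin_subset[OF U(1)] by auto
  have "h y * (f - g) y = 0" if "y \<in> Y" for y
    using h(3) fg(3) that by (cases "h y = 0") auto
  then show ?thesis using integral[OF h(1) diff[OF fg(1,2)]] h(2) \<open>u \<in> Y\<close> x by auto
qed

section \<open>The coordinate ring of an irreducible variety\<close>

abbreviation "CR \<equiv> coordinate_ring A Y"

lemma carrier_CR: "carrier CR = (\<lambda>f. restrict f Y) ` A"
  and mult_CR: "f \<otimes>\<^bsub>CR\<^esub> g = (\<lambda>x\<in>Y. f x * g x)"
  and add_CR: "f \<oplus>\<^bsub>CR\<^esub> g = (\<lambda>x\<in>Y. f x + g x)"
  and one_CR: "\<one>\<^bsub>CR\<^esub> = (\<lambda>x\<in>Y. 1)"
  and zero_CR: "\<zero>\<^bsub>CR\<^esub> = (\<lambda>x\<in>Y. 0)"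
  by (simp_all add: coordinate_ring_def)

lemmas CR_simps = carrier_CR mult_CR add_CR one_CR zero_CR

lemma restrict_mem_CR: "f \<in> A \<Longrightarrow> restrict f Y \<in> carrier CR"
  by (simp add: carrier_CR)

lemma CR_E:
  assumes "a \<in> carrier CR" obtains f where "f \<in> A" "a = restrict f Y"
  using assms by (auto simp: carrier_CR)

lemma restrict_add: "(\<lambda>x\<in>Y. restrict f Y x + restrict g Y x) = restrict (f + g) Y"
  and restrict_mult: "(\<lambda>x\<in>Y. restrict f Y x * restrict g Y x) = restrict (f * g) Y"
  by (auto simp: restrict_def fun_eq_iff)

lemma CR_add_closed: "a \<in> carrier CR \<Longrightarrow> b \<in> carrier CR \<Longrightarrow> a \<oplus>\<^bsub>CR\<^esub> b \<in> carrier CR"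
  and CR_mult_closed: "a \<in> carrier CR \<Longrightarrow> b \<in> carrier CR \<Longrightarrow> a \<otimes>\<^bsub>CR\<^esub> b \<in> carrier CR"
  by (auto elim!: CR_E simp: add_CR mult_CR restrict_add restrict_mult
      restrict_mem_CR add mult simp del: restrict_apply)

lemma CR_domain: "domain CR"
proof (rule domainI)
  show "cring CR"
  proof (rule cringI)
    show "abelian_group CR"
    proof (rule abelian_groupI)
      show "\<zero>\<^bsub>CR\<^esub> \<in> carrier CR" using restrict_mem_CR[OF const[of 0]] by (simp add: zero_CR)
      fix x assume "x \<in> carrier CR"
      then obtain f where f: "f \<in> A" "x = restrict f Y" by (rule CR_E)
      then show "\<zero>\<^bsub>CR\<^esub> \<oplus>\<^bsub>CR\<^esub> x = x" by (auto simp: CR_simps fun_eq_iff)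
      have "restrict (- f) Y \<oplus>\<^bsub>CR\<^esub> x = \<zero>\<^bsub>CR\<^esub>" using f by (auto simp: CR_simps fun_eq_iff)
      then show "\<exists>y\<in>carrier CR. y \<oplus>\<^bsub>CR\<^esub> x = \<zero>\<^bsub>CR\<^esub>"
        using restrict_mem_CR[OF uminus[OF f(1)]] by blast
    qed (simp_all add: CR_add_closed, auto simp: add_CR algebra_simps fun_eq_iff)
    show "Group.comm_monoid CR"
    proof (rule comm_monoidI)
      show "\<one>\<^bsub>CR\<^esub> \<in> carrier CR" using restrict_mem_CR[OF const[of 1]] by (simp add: one_CR)
    qed (simp_all add: CR_mult_closed, auto elim!: CR_E simp: one_CR mult_CR algebra_simps fun_eq_iff)
  qed (auto simp: mult_CR add_CR algebra_simps fun_eq_iff)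
  show "\<one>\<^bsub>CR\<^esub> \<noteq> \<zero>\<^bsub>CR\<^esub>" using Y_nonempty by (auto simp: CR_simps fun_eq_iff)
  fix a b assume ab: "a \<otimes>\<^bsub>CR\<^esub> b = \<zero>\<^bsub>CR\<^esub>" "a \<in> carrier CR" "b \<in> carrier CR"
  obtain f g where fg: "f \<in> A" "a = restrict f Y" "g \<in> A" "b = restrict g Y"
    using ab(2,3) CR_E by metis
  have "\<forall>x\<in>Y. f x * g x = 0" using ab(1) by (auto simp: fg mult_CR zero_CR fun_eq_iff split: if_splits)
  then show "a = \<zero>\<^bsub>CR\<^esub> \<or> b = \<zero>\<^bsub>CR\<^esub>"
    using integral[OF fg(1,3)] by (auto simp: fg zero_CR fun_eq_iff)
qed

sublocale CR: domain CR by (rule CR_domain)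

section \<open>Values of rational functions\<close>

lemma fraction_mem_pointwise:
  assumes "(c, d) \<in> fraction CR a b" "x \<in> Y"
  shows "a x * d x = c x * b x"
  using assms by (auto simp: fraction_def mult_CR dest: fun_cong[of _ _ x])

lemma rational_function_unique:
  assumes ab: "a \<in> carrier CR" "b \<in> carrier CR - {\<zero>\<^bsub>CR\<^esub>}" and x: "x \<in> Y"
    and cd: "(c, d) \<in> fraction CR a b" "d x \<noteq> 0"
  shows "rational_function Y (fraction CR a b) x = Some (c x / d x)"
proof -
  have "c' x / d' x = c x / d x" if cd': "(c', d') \<in> fraction CR a b" "d' x \<noteq> 0" for c' d'
  proof -
    have "fraction CR c d = fraction CR c' d'"
      using CR.fraction_memE(3)[OF cd(1) ab] CR.fraction_memE(3)[OF cd'(1) ab] by simp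
    then have "(c', d') \<in> fraction CR c d"
      using CR.fraction_self_mem CR.fraction_memE(1,2)[OF cd'(1) ab] by simp
    from fraction_mem_pointwise[OF this x] show ?thesis using cd(2) cd'(2) by (simp add: field_simps)
  qed
  note unique = this
  have "(THE z. \<exists>(c, d)\<in>fraction CR a b. d x \<noteq> 0 \<and> z = c x / d x) = c x / d x"
  proof (rule the_equality)
    show "\<exists>(c', d')\<in>fraction CR a b. d' x \<noteq> 0 \<and> c x / d x = c' x / d' x" using cd by blast
    fix z assume "\<exists>(c, d)\<in>fraction CR a b. d x \<noteq> 0 \<and> z = c x / d x"
    then obtain c' d' where "(c', d') \<in> fraction CR a b" "d' x \<noteq> 0" "z = c' x / d' x" by blast
    then show "z = c x / d x" using unique by simp
  qed
  moreover have "\<exists>(c, d)\<in>fraction CR a b. d x \<noteq> 0" using cd by blast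
  ultimately show ?thesis using x by (simp add: rational_function_def)
qed

text \<open>Stated without division: the function can be defined at \<open>x\<close> through another
  representative although \<open>b x = 0\<close>.\<close>

lemma rational_function_SomeD:
  assumes ab: "a \<in> carrier CR" "b \<in> carrier CR - {\<zero>\<^bsub>CR\<^esub>}"
    and z: "rational_function Y (fraction CR a b) x = Some z"
  shows "x \<in> Y" "z * b x = a x"
proof -
  obtain c d where x: "x \<in> Y" and cd: "(c, d) \<in> fraction CR a b" "d x \<noteq> 0"
    using z by (auto simp: rational_function_def split: if_splits)
  have "z = c x / d x" using z rational_function_unique[OF ab x cd] by simp
  then have "z * d x = c x" using cd(2) by simp
  then have "z * b x * d x = a x * d x"
    unfolding fraction_mem_pointwise[OF cd(1) x] by (simp add: mult_ac)
  then show "z * b x = a x" using cd(2) by simp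
  show "x \<in> Y" by (rule x)
qed

lemma rational_function_as_fraction:
  assumes "a \<in> carrier CR" "x \<in> Y"
  shows "rational_function Y (as_fraction CR a) x = Some (a x)"
  using rational_function_unique[OF assms(1) _ assms(2), of "\<one>\<^bsub>CR\<^esub>" a "\<one>\<^bsub>CR\<^esub>"]
    CR.fraction_self_mem[OF assms(1), of "\<one>\<^bsub>CR\<^esub>"] assms
  by (simp add: as_fraction_def) (simp add: one_CR)

lemma CR_eqI_open:
  assumes U: "openin (subtopology (zariski_topology A) Y) U" "U \<noteq> {}"
    and ab: "a \<in> carrier CR" "b \<in> carrier CR" "\<And>x. x \<in> U \<Longrightarrow> a x = b x"
  shows "a = b"
proof -
  obtain f g where fg: "f \<in> A" "a = restrict f Y" "g \<in> A" "b = restrict g Y"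
    using ab CR_E by metis
  have "\<forall>x\<in>U. f x = g x"
  proof
    fix x assume "x \<in> U"
    then show "f x = g x" using ab(3)[of x] fg openin_subset[OF U(1)] by auto
  qed
  then show ?thesis using eq_if_eq_on_open[OF U fg(1,3)] fg(2,4) by (auto simp: restrict_def fun_eq_iff)
qed

text \<open>The two open sets of agreement meet because \<open>Y\<close> is irreducible, and an
  identity of regular functions on the intersection spreads to \<open>Y\<close>. This makes the
  restriction of a rational function well defined.\<close>

lemma generically_equal_trans_unique:
  assumes q: "q \<in> carrier (function_field A Y)" "q' \<in> carrier (function_field A Y)"
    and gen: "generically_equal A Y f (rational_function Y q)" "generically_equal A Y f (rational_function Y q')"
  shows "q = q'"
proof -
  obtain a b a' b' where q_eq: "q = fraction CR a b" "q' = fraction CR a' b'"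
    and ab: "a \<in> carrier CR" "b \<in> carrier CR - {\<zero>\<^bsub>CR\<^esub>}" "a' \<in> carrier CR" "b' \<in> carrier CR - {\<zero>\<^bsub>CR\<^esub>}"
    using q by (auto simp: function_field_def fraction_field_def)
  obtain U U' where U: "openin (subtopology (zariski_topology A) Y) U" "U \<noteq> {}"
      "U \<subseteq> dom (rational_function Y q)" "\<And>x. x \<in> U \<Longrightarrow> f x = rational_function Y q x"
    and U': "openin (subtopology (zariski_topology A) Y) U'" "U' \<noteq> {}"
      "\<And>x. x \<in> U' \<Longrightarrow> f x = rational_function Y q' x"
    using gen unfolding generically_equal_def by blast
  have "a x * b' x = a' x * b x" if "x \<in> U \<inter> U'" for x
  proof -
    obtain z where z: "rational_function Y q x = Some z" using U(3) \<open>x \<in> U \<inter> U'\<close> by blast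
    then have "rational_function Y q' x = Some z" using U(4) U'(3) \<open>x \<in> U \<inter> U'\<close> by (metis IntD1 IntD2)
    then have "z * b' x = a' x" "z * b x = a x"
      using rational_function_SomeD(2)[OF ab(1,2), of x z] z rational_function_SomeD(2)[OF ab(3,4), of x z]
      unfolding q_eq by auto
    then show ?thesis by (metis mult.commute mult.left_commute)
  qed
  then have "(a \<otimes>\<^bsub>CR\<^esub> b') x = (a' \<otimes>\<^bsub>CR\<^esub> b) x" if "x \<in> U \<inter> U'" for x
    using that openin_subset[OF U(1)] by (auto simp: mult_CR)
  then have "a \<otimes>\<^bsub>CR\<^esub> b' = a' \<otimes>\<^bsub>CR\<^esub> b"
    using ab
    by (intro CR_eqI_open[OF openin_Int[OF U(1) U'(1)] open_subsets_meet[OF U(1,2) U'(1,2)]]) auto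
  then show ?thesis unfolding q_eq using CR.fraction_eq_iff[OF ab] by blast
qed

end

text \<open>The denominators of a regular function form an ideal without zeros.\<close>

lemma (in affine_algebra) regular_on_imp_polynomial:
  assumes Y: "closedin (zariski_topology A) Y" and h: "regular_on A Y Y h"
  obtains f where "f \<in> A" "\<forall>y\<in>Y. h y = f y"
proof -
  define J where "J = {b \<in> A. \<exists>a\<in>A. \<forall>y\<in>Y. b y * h y = a y}"
  have "is_ideal J"
  proof (rule is_idealI)
    show "0 \<in> J" unfolding J_def by (auto intro!: bexI[of _ 0])
  next
    fix f g assume "f \<in> J" "g \<in> J"
    then obtain a b where "f \<in> A" "g \<in> A" "a \<in> A" "b \<in> A" "\<forall>y\<in>Y. f y * h y = a y" "\<forall>y\<in>Y. g y * h y = b y"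
      unfolding J_def by blast
    then show "f + g \<in> J" unfolding J_def by (auto intro!: bexI[of _ "a + b"] simp: algebra_simps add)
  next
    fix f g assume "f \<in> A" "g \<in> J"
    then obtain b where "f \<in> A" "g \<in> A" "b \<in> A" "\<forall>y\<in>Y. g y * h y = b y"
      unfolding J_def by blast
    then show "f * g \<in> J" unfolding J_def by (auto intro!: bexI[of _ "f * b"] simp: algebra_simps mult)
  qed (auto simp: J_def)
  moreover have "\<exists>b\<in>J. b y \<noteq> 0" for y
  proof (cases "y \<in> Y")
    case False
    \<comment> \<open>Off \<open>Y\<close>, a function vanishing on \<open>Y\<close> but not at
      \<open>y\<close> is a denominator with numerator 0; here closedness of \<open>Y\<close>
      enters.\<close>
    obtain f where f: "f \<in> A" "f y \<noteq> 0" "\<forall>z\<in>Y. f z = 0" using closedin_zariskiD[OF Y False] by blast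
    then have "f \<in> J" unfolding J_def by (auto intro!: bexI[of _ 0])
    then show ?thesis using f(2) by blast
  next
    case True
    then obtain O' a b where O': "openin (subtopology (zariski_topology A) Y) O'" "y \<in> O'"
      and ab: "a \<in> A" "b \<in> A" "\<forall>z\<in>O'. b z \<noteq> 0 \<and> h z = a z / b z"
      using bspec[OF h[unfolded regular_on_def] True] by blast
    obtain g where g: "g \<in> A" "g y \<noteq> 0" "\<forall>z\<in>Y. g z \<noteq> 0 \<longrightarrow> z \<in> O'"
      using openin_subtopology_zariskiD[OF O'] by blast
    \<comment> \<open>Multiplying by \<open>g\<close>, which vanishes on \<open>Y\<close> outside
      \<open>O'\<close>, makes the local identity valid on all of \<open>Y\<close>.\<close>
    have "(g * b) z * h z = (g * a) z" if "z \<in> Y" for z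
      using g(3) ab(3) that by (cases "g z = 0") auto
    then have "g * b \<in> J" unfolding J_def using g(1) ab(1,2) mult by blast
    moreover have "(g * b) y \<noteq> 0" using g(2) ab(3) O'(2) by auto
    ultimately show ?thesis by blast
  qed
  ultimately have "1 \<in> J" using nullstellensatz by blast
  then obtain f where "f \<in> A" "\<forall>y\<in>Y. 1 * h y = f y" unfolding J_def by auto
  then show ?thesis using that by simp
qed

section \<open>The spectrum of a factorial algebra\<close>

text \<open>Induction along a factorisation into primes. It serves to cancel primes from a
  denominator and to find a prime element in a prime ideal.\<close>

lemma (in factorial_domain) factorial_induct [consumes 2, case_names unit prime]:
  assumes "b \<in> carrier R" "b \<noteq> \<zero>"
    and unit: "\<And>u. u \<in> Units R \<Longrightarrow> Q u"
    and step: "\<And>p c. p \<in> carrier R \<Longrightarrow> ring_prime p \<Longrightarrow> c \<in> carrier R \<Longrightarrow> c \<noteq> \<zero> \<Longrightarrow> Q c \<Longrightarrow> Q (p \<otimes> c)"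
  shows "Q b"
proof (cases "b \<in> Units R")
  case False
  then obtain fs where fs: "set fs \<subseteq> carrier R - {\<zero>}" "factors (mult_of R) fs b"
    using factors_exist[of b] assms(1,2) by auto
  have "Q (foldr (\<otimes>) fs \<one>) \<and> foldr (\<otimes>) fs \<one> \<in> carrier R - {\<zero>}"
    if "set fs \<subseteq> carrier R - {\<zero>}" "\<forall>p\<in>set fs. irreducible (mult_of R) p" for fs
    using that
  proof (induction fs)
    case (Cons p fs)
    have "ring_prime p"
      using Cons.prems irreducible_prime[of p] by (intro ring_primeI') auto
    then show ?case using Cons step[of p "foldr (\<otimes>) fs \<one>"] by (auto simp: integral_iff)
  qed (simp add: unit)
  then show ?thesis using fs unfolding factors_def by auto
qed (rule unit)

locale factorial_algebra = function_algebra +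
  assumes countable_span: "\<exists>E. countable E \<and> A \<subseteq> fun_vs.span E"
    and factorial: "factorial_domain (coordinate_ring A UNIV)"
begin

abbreviation "SR \<equiv> coordinate_ring A UNIV"

sublocale SR: factorial_domain SR by (rule factorial)

lemma SR_simps [simp]:
  "carrier SR = A" "f \<otimes>\<^bsub>SR\<^esub> g = f * g" "f \<oplus>\<^bsub>SR\<^esub> g = f + g" "\<one>\<^bsub>SR\<^esub> = 1" "\<zero>\<^bsub>SR\<^esub> = 0"
  by (auto simp: coordinate_ring_def restrict_def fun_eq_iff image_def)

lemma A_integral: "f \<in> A \<Longrightarrow> g \<in> A \<Longrightarrow> f * g = 0 \<Longrightarrow> f = 0 \<or> g = 0"
  using SR.integral[of f g] by simp

section \<open>Principal ideals and prime elements\<close>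

definition multiples :: "('a \<Rightarrow> complex) \<Rightarrow> ('a \<Rightarrow> complex) set" where
  "multiples p = (\<lambda>h. p * h) ` A"

definition prime_element :: "('a \<Rightarrow> complex) \<Rightarrow> bool" where
  "prime_element p \<longleftrightarrow> p \<in> A \<and> p \<noteq> 0 \<and> 1 \<notin> multiples p \<and>
     (\<forall>f\<in>A. \<forall>g\<in>A. f * g \<in> multiples p \<longrightarrow> f \<in> multiples p \<or> g \<in> multiples p)"

lemma divides_SR_iff: "p divides\<^bsub>SR\<^esub> f \<longleftrightarrow> f \<in> multiples p"
  by (auto simp: factor_def multiples_def)

lemma ring_prime_SR_imp:
  assumes "p \<in> A" "ring_prime\<^bsub>SR\<^esub> p" shows "prime_element p"
proof -
  have "p \<noteq> 0" "Divisibility.prime SR p" using SR.ring_primeE[of p] assms by auto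
  moreover from this(2) have "1 \<notin> multiples p"
    using SR.divides_one[of p] assms(1) unfolding prime_def divides_SR_iff SR_simps by blast
  ultimately show ?thesis
    using assms(1) unfolding prime_element_def prime_def divides_SR_iff SR_simps by blast
qed

lemma factorial_induct [consumes 2, case_names unit prime]:
  assumes "b \<in> A" "b \<noteq> 0"
    and unit: "\<And>u v. u \<in> A \<Longrightarrow> v \<in> A \<Longrightarrow> u * v = 1 \<Longrightarrow> Q u"
    and step: "\<And>p c. prime_element p \<Longrightarrow> c \<in> A \<Longrightarrow> c \<noteq> 0 \<Longrightarrow> Q c \<Longrightarrow> Q (p * c)"
  shows "Q b"
proof -
  have "b \<in> carrier SR" "b \<noteq> \<zero>\<^bsub>SR\<^esub>" using assms(1,2) by auto
  then show ?thesis
  proof (induction rule: SR.factorial_induct)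
    case (unit u)
    then show ?case using assms(3)[of u] by (auto simp: Units_def)
  next
    case (prime p c)
    then have "Q (p * c)" by (intro step ring_prime_SR_imp) auto
    then show ?case by (simp only: SR_simps)
  qed
qed

lemma multiples_is_ideal:
  assumes "p \<in> A" shows "is_ideal (multiples p)"
proof (rule is_idealI)
  show "multiples p \<subseteq> A" using assms by (auto simp: multiples_def)
  show "0 \<in> multiples p" unfolding multiples_def by (intro image_eqI[of _ _ 0]) auto
  fix f g assume "f \<in> multiples p" "g \<in> multiples p"
  then obtain h k where "f = p * h" "g = p * k" "h \<in> A" "k \<in> A" unfolding multiples_def by blast
  then show "f + g \<in> multiples p"
    unfolding multiples_def by (intro image_eqI[of _ _ "h + k"]) (auto simp: algebra_simps)
next
  fix f g assume "f \<in> A" "g \<in> multiples p"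
  then obtain h where "g = p * h" "h \<in> A" unfolding multiples_def by blast
  then show "f * g \<in> multiples p" using \<open>f \<in> A\<close>
    unfolding multiples_def by (intro image_eqI[of _ _ "f * h"]) (auto simp: algebra_simps)
qed

lemma multiples_self: "p \<in> multiples p"
  unfolding multiples_def by (intro image_eqI[of _ _ 1]) auto

lemma prime_element_power:
  assumes "prime_element p" "f \<in> A" "f ^ n \<in> multiples p" shows "f \<in> multiples p"
  using assms(3)
proof (induction n)
  case 0
  then show ?case using assms(1) unfolding prime_element_def power_0 by blast
next
  case (Suc n)
  then show ?case using assms(1,2) power[OF assms(2), of n] unfolding prime_element_def power_Suc by blast
qed

text \<open>From \<open>q = p * h\<close>, the prime \<open>q\<close> divides \<open>p\<close> or
  \<open>h\<close>; in the second case cancelling \<open>q\<close> would make \<open>p\<close> a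
  unit.\<close>

lemma prime_multiple_of_prime:
  assumes p: "prime_element p" and q: "prime_element q" "q \<in> multiples p"
  shows "p \<in> multiples q"
proof -
  obtain h where h: "h \<in> A" "q = p * h" using q(2) unfolding multiples_def by blast
  have pA: "p \<in> A" "p \<noteq> 0" "1 \<notin> multiples p" "q \<in> A" "q \<noteq> 0"
    using p q unfolding prime_element_def by auto
  have "p * h \<in> multiples q" using h(2) multiples_self by simp
  then have "p \<in> multiples q \<or> h \<in> multiples q"
    using q(1) pA(1) h(1) unfolding prime_element_def by blast
  moreover have "h \<notin> multiples q"
  proof
    assume "h \<in> multiples q"
    then obtain k where k: "k \<in> A" "h = q * k" unfolding multiples_def by blast
    have "q = p * (q * k)" using h(2) k(2) by simp
    then have "q * (1 - p * k) = 0" by (simp add: algebra_simps)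
    then have "1 - p * k = 0" using A_integral[OF pA(4), of "1 - p * k"] pA k(1) by blast
    then have "1 = p * k" by simp
    then show False using pA(3) k(1) unfolding multiples_def by blast
  qed
  ultimately show ?thesis by blast
qed

section \<open>Maximal ideals and their Zariski topology\<close>

lemma ideal_SR_iff: "ideal I SR \<longleftrightarrow> is_ideal I"
proof
  assume "ideal I SR"
  then interpret ideal I SR .
  show "is_ideal I"
    using a_subset zero_closed a_closed I_l_closed by (intro is_idealI) auto
next
  assume I: "is_ideal I"
  note ID = is_idealD[OF I]
  show "ideal I SR"
  proof (rule idealI[OF SR.ring_axioms])
    show "subgroup I (add_monoid SR)"
    proof (rule SR.add.subgroupI)
      fix a assume a: "a \<in> I"
      have "\<ominus>\<^bsub>SR\<^esub> a = - a"
        using ID(1) a SR.minus_equality[of "- a" a] by auto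
      then show "\<ominus>\<^bsub>SR\<^esub> a \<in> I" using is_ideal_uminus[OF I a] by simp
    qed (use ID in auto)
  qed (use ID in auto)
qed

abbreviation "Z \<equiv> mSpec SR"

lemma maximalidealD:
  assumes "maximalideal m SR"
  shows "is_ideal m" "1 \<notin> m"
    "\<And>f g. f \<in> A \<Longrightarrow> g \<in> A \<Longrightarrow> f * g \<in> m \<Longrightarrow> f \<in> m \<or> g \<in> m"
    "\<And>J. is_ideal J \<Longrightarrow> m \<subseteq> J \<Longrightarrow> 1 \<notin> J \<Longrightarrow> J = m"
proof -
  interpret maximalideal m SR by fact
  show m: "is_ideal m" using ideal_axioms ideal_SR_iff by blast
  show one: "1 \<notin> m" using one_imp_carrier I_notcarr by auto
  show "J = m" if "is_ideal J" "m \<subseteq> J" "1 \<notin> J" for J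
    using I_maximal[of J] that is_idealD(1)[of J] one by (auto simp: ideal_SR_iff)
  show "f \<in> m \<or> g \<in> m" if "f \<in> A" "g \<in> A" "f * g \<in> m" for f g
    using primeideal.I_prime[OF SR.maximalideal_prime[OF assms], of f g] that by auto
qed

text \<open>An element outside the kernel can be scaled to an element \<open>k\<close> of value 1;
  then \<open>1 - k\<close> is in the kernel, so a larger ideal contains 1.\<close>

lemma maximalideal_kernel:
  assumes ev: "\<And>c. ev (\<lambda>_. c) = c"
    "\<And>f g. f \<in> A \<Longrightarrow> g \<in> A \<Longrightarrow> ev (f + g) = ev f + ev g"
    "\<And>f g. f \<in> A \<Longrightarrow> g \<in> A \<Longrightarrow> ev (f * g) = ev f * (ev g :: complex)"
  shows "maximalideal {f \<in> A. ev f = 0} SR"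
proof (rule maximalidealI)
  let ?m = "{f \<in> A. ev f = 0}"
  show "ideal ?m SR" unfolding ideal_SR_iff
    using ev(1)[of 0] by (intro is_idealI) (auto simp: ev zero_fun_def[symmetric])
  have "(\<lambda>_. 1) \<in> carrier SR" "(\<lambda>_. 1) \<notin> ?m" using ev(1)[of 1] by simp_all
  then show "carrier SR \<noteq> ?m" by metis
  fix J assume J: "ideal J SR" "?m \<subseteq> J" "J \<subseteq> carrier SR"
  have J': "is_ideal J" using J(1) ideal_SR_iff by blast
  show "J = ?m \<or> J = carrier SR"
  proof (cases "J = ?m")
    case False
    then obtain g where g: "g \<in> J" "ev g \<noteq> 0" "g \<in> A" using J by auto
    define k where "k = (\<lambda>_. inverse (ev g)) * g"
    have k: "k \<in> J" "k \<in> A" "ev k = 1"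
      using g is_idealD(4)[OF J', of "\<lambda>_. inverse (ev g)" g] ev(3)[OF const g(3)] ev(1)
      unfolding k_def by auto
    have "1 - k \<in> ?m"
      using k ev(2)[of "1 - k" k] ev(1)[of 1] by (auto simp: one_fun_def)
    then have "(1 - k) + k \<in> J" using J(2) k(1) is_idealD(3)[OF J'] by blast
    then have "1 \<in> J" by simp
    then have "f \<in> J" if "f \<in> A" for f using is_idealD(4)[OF J' that, of 1] by simp
    then show ?thesis using J(3) by auto
  qed simp
qed

text \<open>This is the Jacobson property.\<close>

lemma maximalideal_avoiding:
  assumes "is_ideal I" "\<And>n. a ^ n \<notin> I" "a \<in> A"
  obtains m where "maximalideal m SR" "I \<subseteq> m" "a \<notin> m"
proof -
  obtain E where E: "countable E" "A \<subseteq> fun_vs.span E" using countable_span by blast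
  obtain ev :: "('a \<Rightarrow> complex) \<Rightarrow> complex" where ev: "\<And>c. ev (\<lambda>_. c) = c"
    "\<And>f g. f \<in> A \<Longrightarrow> g \<in> A \<Longrightarrow> ev (f + g) = ev f + ev g"
    "\<And>f g. f \<in> A \<Longrightarrow> g \<in> A \<Longrightarrow> ev (f * g) = ev f * ev g"
    "\<And>f. f \<in> I \<Longrightarrow> ev f = 0" "ev a \<noteq> 0"
    by (rule exists_character[OF E assms]) auto
  show ?thesis
    by (rule that[OF maximalideal_kernel[of ev]]) (use ev is_idealD(1)[OF assms(1)] in auto)
qed

lemma maximalideal_avoiding_prime:
  assumes "prime_element p" "a \<in> A" "a \<notin> multiples p"
  obtains m where "maximalideal m SR" "p \<in> m" "a \<notin> m"
proof -
  have "a ^ n \<notin> multiples p" for n using prime_element_power assms by blast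
  moreover have "is_ideal (multiples p)" using assms(1) multiples_is_ideal unfolding prime_element_def by blast
  ultimately obtain m where "maximalideal m SR" "multiples p \<subseteq> m" "a \<notin> m"
    using maximalideal_avoiding[of "multiples p" a] assms(2) by blast
  then show ?thesis using that multiples_self by blast
qed

lemma topspace_Z: "topspace Z = {m. maximalideal m SR}"
proof -
  have "m \<in> {\<mm>. maximalideal \<mm> SR \<and> 1 \<notin> \<mm>}" if "maximalideal m SR" for m
    using maximalidealD(2) that by blast
  then show ?thesis unfolding mSpec_def topology_generated_by_topspace using one by (auto simp del: one)
qed

lemma openin_Z_basic: "f \<in> A \<Longrightarrow> openin Z {m. maximalideal m SR \<and> f \<notin> m}"
  unfolding mSpec_def by (intro topology_generated_by_Basis) auto

lemma closedin_Z_zeros: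
  assumes "f \<in> A" shows "closedin Z {m. maximalideal m SR \<and> f \<in> m}"
proof -
  have "topspace Z - {m. maximalideal m SR \<and> f \<in> m} = {m. maximalideal m SR \<and> f \<notin> m}"
    unfolding topspace_Z by auto
  then show ?thesis using openin_Z_basic[OF assms] by (auto simp: closedin_def topspace_Z)
qed

lemma closedin_ZD:
  assumes "closedin Z C" "maximalideal m SR" "m \<notin> C"
  obtains f where "f \<in> A" "f \<notin> m" "\<forall>n\<in>C. f \<in> n"
proof -
  let ?S = "{{\<mm>. maximalideal \<mm> SR \<and> f \<notin> \<mm>} | f. f \<in> carrier SR}"
  have "openin (topology_generated_by ?S) (topspace Z - C)"
    using assms(1) unfolding mSpec_def closedin_def by blast
  moreover have "m \<in> topspace Z - C" using assms(2,3) topspace_Z by blast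
  moreover have "b \<inter> c \<in> ?S" if bc: "b \<in> ?S" "c \<in> ?S" for b c
  proof -
    obtain f g where fg: "b = {\<mm>. maximalideal \<mm> SR \<and> f \<notin> \<mm>}" "c = {\<mm>. maximalideal \<mm> SR \<and> g \<notin> \<mm>}"
      "f \<in> A" "g \<in> A" using bc by auto
    have "b \<inter> c = {\<mm>. maximalideal \<mm> SR \<and> f * g \<notin> \<mm>}"
    proof (rule Set.set_eqI)
      fix n
      have "f * g \<in> n \<longleftrightarrow> f \<in> n \<or> g \<in> n" if n: "maximalideal n SR"
        using maximalidealD(3)[OF n fg(3,4)] is_idealD(4,5)[OF maximalidealD(1)[OF n]] fg(3,4) by metis
      then show "n \<in> b \<inter> c \<longleftrightarrow> n \<in> {\<mm>. maximalideal \<mm> SR \<and> f * g \<notin> \<mm>}"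
        unfolding fg by blast
    qed
    moreover have "f * g \<in> carrier SR" using mult[OF fg(3,4)] by (simp only: SR_simps)
    ultimately show ?thesis by (intro CollectI exI[of _ "f * g"] conjI)
  qed
  ultimately obtain b where b: "b \<in> ?S" "m \<in> b" "b \<subseteq> topspace Z - C"
    by (rule openin_basis_refinement)
  then obtain f where f: "f \<in> A" "b = {\<mm>. maximalideal \<mm> SR \<and> f \<notin> \<mm>}" by auto
  have "\<forall>n\<in>C. f \<in> n" using b(3) f(2) closedin_subset[OF assms(1)] topspace_Z by blast
  then show ?thesis using that f b(2) by blast
qed

section \<open>Prime divisors in the spectrum\<close>

definition V :: "('a \<Rightarrow> complex) \<Rightarrow> ('a \<Rightarrow> complex) set set" where
  "V p = {m. maximalideal m SR \<and> p \<in> m}"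

text \<open>By the Jacobson property the prime ideal of multiples of \<open>p\<close> is the
  intersection of the maximal ideals above it. Vanishing on \<open>V p\<close> is thereby turned
  into divisibility.\<close>

lemma in_all_of_V_imp_multiple:
  assumes "prime_element p" "f \<in> A" "\<And>m. m \<in> V p \<Longrightarrow> f \<in> m"
  shows "f \<in> multiples p"
  using maximalideal_avoiding_prime[of p f] assms unfolding V_def by blast

lemma multiple_in_V: "f \<in> multiples p \<Longrightarrow> m \<in> V p \<Longrightarrow> f \<in> m"
  using is_idealD(5)[OF maximalidealD(1), of m] unfolding V_def multiples_def by auto

text \<open>Irreducibility of the closed set is primality of its ideal: functions that separate
  points of \<open>V p\<close> from \<open>C\<close> and from \<open>D\<close> would have a product
  divisible by \<open>p\<close>.\<close>

lemma V_irreducible: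
  assumes p: "prime_element p"
  shows "irreducible_subset Z (V p)"
  unfolding irreducible_subset_def
proof (intro conjI allI impI)
  show "V p \<subseteq> topspace Z" unfolding V_def topspace_Z by blast
  have "1 \<notin> multiples p" using p unfolding prime_element_def by blast
  then show "V p \<noteq> {}" using in_all_of_V_imp_multiple[OF p one] by blast
  fix C D assume CD: "closedin Z C \<and> closedin Z D \<and> V p \<subseteq> C \<union> D"
  show "V p \<subseteq> C \<or> V p \<subseteq> D"
  proof (rule ccontr)
    assume "\<not> ?thesis"
    then obtain m n where mn: "m \<in> V p" "m \<notin> C" "n \<in> V p" "n \<notin> D" by blast
    obtain f where f: "f \<in> A" "f \<notin> m" "\<forall>n\<in>C. f \<in> n"
      using closedin_ZD[of C m] CD mn(1,2) unfolding V_def by blast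
    obtain g where g: "g \<in> A" "g \<notin> n" "\<forall>n\<in>D. g \<in> n"
      using closedin_ZD[of D n] CD mn(3,4) unfolding V_def by blast
    have "f * g \<in> k" if k: "k \<in> V p" for k
    proof -
      have "is_ideal k" using k maximalidealD(1) unfolding V_def by blast
      moreover have "f \<in> k \<or> g \<in> k" using k CD f(3) g(3) by blast
      ultimately show ?thesis using is_idealD(4,5) f(1) g(1) by blast
    qed
    then have "f * g \<in> multiples p" by (intro in_all_of_V_imp_multiple[OF p] mult f g)
    then have "f \<in> multiples p \<or> g \<in> multiples p"
      using p f(1) g(1) unfolding prime_element_def by blast
    then show False using multiple_in_V mn(1,3) f(2) g(2) by blast
  qed
qed

text \<open>A nonzero prime ideal of a factorial ring contains a prime element, so \<open>V p\<close> has height one.\<close>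

lemma codimension_le_1:
  assumes p: "prime_element p" and C: "V p \<subseteq> C"
  shows "codimension Z C \<le> 1"
  unfolding codimension_def
proof (rule Sup_least)
  fix d assume "d \<in> {enat n | n. \<exists>F :: nat \<Rightarrow> ('a \<Rightarrow> complex) set set.
     F 0 = C \<and> (\<forall>i\<le>n. closedin Z (F i) \<and> irreducible_subset Z (F i)) \<and> (\<forall>i<n. F i \<subset> F (Suc i))}"
  then obtain n F where d: "d = enat n" and F: "F 0 = C"
    "\<forall>i\<le>n. closedin Z (F i) \<and> irreducible_subset Z (F i)" "\<forall>i<n. F i \<subset> F (Suc i)" by blast
  have "\<not> 2 \<le> n"
  proof
    assume n: "2 \<le> n"
    define C1 C2 where "C1 = F 1" and "C2 = F 2"
    have C12: "C \<subset> C1" "C1 \<subset> C2" using F(1) F(3)[rule_format, of 0] F(3)[rule_format, of 1] n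
      by (auto simp: C1_def C2_def numeral_2_eq_2)
    have cl: "closedin Z C" "closedin Z C1" "closedin Z C2" "irreducible_subset Z C1"
      using F(2)[rule_format, of 0] F(2)[rule_format, of 1] F(2)[rule_format, of 2] n F(1)
      by (auto simp: C1_def C2_def)
    have max: "maximalideal m SR" if "m \<in> C2" for m
      using that closedin_subset[OF cl(3)] topspace_Z by blast
    obtain m1 where m1: "m1 \<in> C1" "m1 \<notin> C" using C12 by blast
    obtain m2 where m2: "m2 \<in> C2" "m2 \<notin> C1" using C12 by blast
    obtain f where f: "f \<in> A" "f \<notin> m2" "\<forall>m\<in>C1. f \<in> m"
      using closedin_ZD[OF cl(2) max[OF m2(1)] m2(2)] by blast
    have max1: "maximalideal m1 SR" using max m1(1) C12 by blast
    obtain g where g: "g \<in> A" "g \<notin> m1" "\<forall>m\<in>C. g \<in> m"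
      using closedin_ZD[OF cl(1) max1 m1(2)] by blast
    have "f \<noteq> 0" using f(2) is_idealD(2)[OF maximalidealD(1)[OF max[OF m2(1)]]] by blast
    \<comment> \<open>The functions vanishing on \<open>C1\<close> form a prime ideal. It is nonzero
      because \<open>C2\<close> has a point outside \<open>C1\<close>, which is what
      \<open>f\<close> detects.\<close>
    have prime_I: "(\<forall>m\<in>C1. h \<in> m) \<or> (\<forall>m\<in>C1. k \<in> m)"
      if hk: "h \<in> A" "k \<in> A" "\<forall>m\<in>C1. h * k \<in> m" for h k
    proof -
      have "C1 \<subseteq> {m. maximalideal m SR \<and> h \<in> m} \<union> {m. maximalideal m SR \<and> k \<in> m}"
        using hk maximalidealD(3) max C12 by blast
      then have "C1 \<subseteq> {m. maximalideal m SR \<and> h \<in> m} \<or> C1 \<subseteq> {m. maximalideal m SR \<and> k \<in> m}"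
        using cl(4) closedin_Z_zeros[OF hk(1)] closedin_Z_zeros[OF hk(2)]
        unfolding irreducible_subset_def by blast
      then show ?thesis by blast
    qed
    have "(\<forall>m\<in>C1. f \<in> m) \<longrightarrow> (\<exists>q. prime_element q \<and> (\<forall>m\<in>C1. q \<in> m))"
      using f(1) \<open>f \<noteq> 0\<close>
    proof (induction rule: factorial_induct)
      case (unit u v)
      then show ?case
        using m1(1) maximalidealD(2)[OF max1] is_idealD(5)[OF maximalidealD(1)[OF max1], of v u] by auto
    next
      case (prime q c)
      then have "q \<in> A" unfolding prime_element_def by blast
      then show ?case using prime_I[of q c] prime by blast
    qed
    then obtain q where q: "prime_element q" "\<forall>m\<in>C1. q \<in> m" using f(3) by blast
    \<comment> \<open>\<open>q\<close> vanishes on \<open>C1\<close>, hence on \<open>V p\<close>,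
      so it is associated to \<open>p\<close>. Then \<open>p\<close> vanishes on \<open>C1\<close>
      as well, which forces \<open>C1\<close> into \<open>V p\<close> and back into
      \<open>C\<close>.\<close>
    have "q \<in> multiples p"
      using q C C12(1) by (intro in_all_of_V_imp_multiple[OF p]) (auto simp: prime_element_def)
    then have "p \<in> multiples q" by (rule prime_multiple_of_prime[OF p q(1)])
    moreover have "m1 \<in> V q" using q(2) m1(1) max1 unfolding V_def by blast
    ultimately have "p \<in> m1" by (rule multiple_in_V)
    then have "m1 \<in> V p" using max1 unfolding V_def by blast
    then show False using C m1(2) by blast
  qed
  then show "d \<le> 1" unfolding d by (simp add: one_enat_def)
qed

text \<open>A function \<open>f\<close> vanishing on the missed set vanishes on \<open>V p\<close>
  wherever \<open>a\<close> does not, so \<open>p\<close> divides \<open>f * a\<close> and hence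
  \<open>f\<close>. Thus the missed set is dense in \<open>V p\<close>, and the component around
  \<open>V p\<close> has codimension at most one.\<close>

lemma not_surjective_up_to_codim_two:
  assumes p: "prime_element p" and a: "a \<in> A" "a \<notin> multiples p"
    and im: "\<And>m. m \<in> V p \<Longrightarrow> a \<notin> m \<Longrightarrow> m \<notin> \<pi> ` Y"
  shows "\<not> surjective_up_to_codim_two \<pi> Y Z"
proof
  assume surj: "surjective_up_to_codim_two \<pi> Y Z"
  let ?S = "Z closure_of (topspace Z - \<pi> ` Y)"
  have "V p \<subseteq> ?S"
  proof
    fix m assume m: "m \<in> V p"
    show "m \<in> ?S"
    proof (rule ccontr)
      assume "m \<notin> ?S"
      then obtain f where f: "f \<in> A" "f \<notin> m" "\<forall>n\<in>?S. f \<in> n"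
        using closedin_ZD[OF closedin_closure_of] m unfolding V_def by blast
      have "f * a \<in> n" if n: "n \<in> V p" for n
      proof -
        have "f \<in> n \<or> a \<in> n"
        proof (cases "a \<in> n")
          case False
          then have "n \<in> topspace Z - \<pi> ` Y" using im[OF n] n unfolding V_def topspace_Z by blast
          then have "n \<in> ?S" using closure_of_subset[of "topspace Z - \<pi> ` Y" Z] by blast
          then show ?thesis using f(3) by blast
        qed simp
        moreover have "is_ideal n" using n maximalidealD(1) unfolding V_def by blast
        ultimately show ?thesis using is_idealD(4,5) f(1) a(1) by blast
      qed
      then have "f * a \<in> multiples p" by (intro in_all_of_V_imp_multiple[OF p] mult f a)
      then have "f \<in> multiples p" using p f(1) a unfolding prime_element_def by blast
      then show False using multiple_in_V m f(2) by blast
    qed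
  qed
  then obtain C where C: "irreducible_component Z ?S C" "V p \<subseteq> C"
    using irreducible_component_exists[OF V_irreducible[OF p]] by blast
  then have "2 \<le> codimension Z C" using surj unfolding surjective_up_to_codim_two_def by blast
  then have "(2 :: enat) \<le> 1" using codimension_le_1[OF p C(2)] by (rule order_trans)
  then show False by (simp add: one_enat_def numeral_eq_enat)
qed

end

section \<open>Restriction of invariants\<close>

locale restriction_data = affine_algebra +
  fixes \<Gamma> :: "('a \<rightharpoonup> 'a) set" and Y :: "'a set"
    and W :: "('w, 'b) monoid_scheme" and \<phi> :: "'w \<Rightarrow> 'a \<rightharpoonup> 'a"
  assumes UNIV_irreducible: "irreducible_subset (zariski_topology A) UNIV"
    and galois: "galois_restriction_property A \<Gamma> Y W \<phi>"
    and action: "faithful_regular_action A Y W \<phi>"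
    and frac: "carrier (invariant_field A UNIV \<Gamma>) =
      {fraction (coordinate_ring A UNIV) a b | a b. a \<in> carrier (invariant_ring A UNIV \<Gamma>) \<and>
         b \<in> carrier (invariant_ring A UNIV \<Gamma>) - {\<zero>\<^bsub>invariant_ring A UNIV \<Gamma>\<^esub>}}"
    and ufd: "factorial_domain (invariant_ring A UNIV \<Gamma>)"
begin

lemma Y_closed: "closedin (zariski_topology A) Y"
  and Y_irreducible: "irreducible_subset (zariski_topology A) Y"
  and W_group: "group W" and W_finite: "finite (carrier W)"
  and restricts_exists: "q \<in> carrier (invariant_field A UNIV \<Gamma>) \<Longrightarrow> \<exists>h. restricts_to A Y q h"
  and restriction_iso: "rational_restriction A Y \<in>
    ring_iso (invariant_field A UNIV \<Gamma>) (invariant_field A Y (\<phi> ` carrier W))"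
  using galois unfolding galois_restriction_property_def closed_subvariety_def by blast+

sublocale W: group W by (rule W_group)

sublocale U: irreducible_variety A UNIV
  by unfold_locales (rule UNIV_irreducible)

sublocale Y: irreducible_variety A Y
  by unfold_locales (rule Y_irreducible)

definition inv_functions :: "('a \<Rightarrow> complex) set" where
  "inv_functions = {f \<in> A. \<forall>\<gamma>\<in>\<Gamma>. \<forall>x y. \<gamma> x = Some y \<longrightarrow> f y = f x}"

lemma inv_functions_subset: "inv_functions \<subseteq> A"
  unfolding inv_functions_def by blast

lemma carrier_U_CR: "carrier U.CR = A"
  by (simp add: coordinate_ring_def restrict_def)

lemma carrier_invariant_ring: "carrier (invariant_ring A UNIV \<Gamma>) = inv_functions"
  unfolding invariant_ring_def inv_functions_def by (simp add: carrier_U_CR)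

text \<open>In this form the results on factorial algebras apply to the invariants.\<close>

lemma invariant_ring_eq: "invariant_ring A UNIV \<Gamma> = coordinate_ring inv_functions UNIV"
proof -
  have "carrier (coordinate_ring inv_functions UNIV) = inv_functions"
    by (simp add: coordinate_ring_def restrict_def)
  then show ?thesis
    using carrier_invariant_ring unfolding invariant_ring_def coordinate_ring_def by simp
qed

sublocale G: factorial_algebra inv_functions
proof (intro factorial_algebra.intro function_algebra.intro factorial_algebra_axioms.intro)
  show "factorial_domain (coordinate_ring inv_functions UNIV)"
    using ufd unfolding invariant_ring_eq .
  show "\<exists>E. countable E \<and> inv_functions \<subseteq> fun_vs.span E"
    using countable_span inv_functions_subset by blast
  show "(\<lambda>_. c) \<in> inv_functions" for c unfolding inv_functions_def by simp
  fix f g assume fg: "f \<in> inv_functions" "g \<in> inv_functions"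
  show "f + g \<in> inv_functions" "f * g \<in> inv_functions"
    using fg add mult unfolding inv_functions_def by auto
qed

abbreviation "CY \<equiv> coordinate_ring A Y"

abbreviation "act w x \<equiv> the (\<phi> w x)"

lemma rational_self_map_act:
  assumes "w \<in> carrier W"
  shows "rational_self_map A Y (\<phi> w)" "dom (\<phi> w) = Y"
  using action assms unfolding faithful_regular_action_def regular_automorphism_def by auto

lemma act:
  assumes "w \<in> carrier W" "x \<in> Y"
  shows "\<phi> w x = Some (act w x)" "act w x \<in> Y"
proof -
  show 1: "\<phi> w x = Some (act w x)" using rational_self_map_act(2)[OF assms(1)] assms(2) by force
  then show "act w x \<in> Y"
    using rational_self_map_act(1)[OF assms(1)] unfolding rational_self_map_def by (auto intro: ranI)
qed

lemma act_map_comp: "w \<in> carrier W \<Longrightarrow> x \<in> Y \<Longrightarrow> (h \<circ>\<^sub>m \<phi> w) x = h (act w x)"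
  using act(1)[of w x] by (cases "\<phi> w x") (auto simp: map_comp_def)

lemma act_mult:
  assumes "v \<in> carrier W" "w \<in> carrier W" "x \<in> Y"
  shows "act (v \<otimes>\<^bsub>W\<^esub> w) x = act v (act w x)"
proof -
  have "\<phi> (v \<otimes>\<^bsub>W\<^esub> w) = \<phi> v \<circ>\<^sub>m \<phi> w"
    using action assms(1,2) unfolding faithful_regular_action_def by blast
  then show ?thesis by (simp add: act_map_comp[OF assms(2,3)] del: map_comp_simps)
qed

text \<open>The pullback is regular, that is, locally a quotient; on the closed set \<open>Y\<close>
  it therefore agrees with one polynomial.\<close>

lemma act_polynomial:
  assumes "w \<in> carrier W" "f \<in> A"
  obtains g where "g \<in> A" "\<forall>x\<in>Y. f (act w x) = g x"
proof -
  have "regular_on A Y Y (\<lambda>x. f (act w x))"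
    using rational_self_map_act[OF assms(1)] assms(2) unfolding rational_self_map_def by auto
  from regular_on_imp_polynomial[OF Y_closed this] show ?thesis using that by blast
qed

text \<open>Polynomials on \<open>V\<close> standing for elements of \<open>C[Y]^W\<close>;
  different members may have the same restriction to \<open>Y\<close>.\<close>

definition W_invariants :: "('a \<Rightarrow> complex) set" where
  "W_invariants = {f \<in> A. \<forall>w\<in>carrier W. \<forall>x\<in>Y. f (act w x) = f x}"

lemma carrier_invariant_ring_W:
  "carrier (invariant_ring A Y (\<phi> ` carrier W)) = (\<lambda>f. restrict f Y) ` W_invariants"
proof -
  have *: "(\<forall>\<gamma>\<in>\<phi> ` carrier W. \<forall>x\<in>Y. \<forall>y. \<gamma> x = Some y \<longrightarrow> restrict f Y y = restrict f Y x)
    \<longleftrightarrow> (\<forall>w\<in>carrier W. \<forall>x\<in>Y. f (act w x) = f x)" for f :: "'a \<Rightarrow> complex"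
  proof -
    have "(\<forall>y. \<phi> w x = Some y \<longrightarrow> restrict f Y y = restrict f Y x) \<longleftrightarrow> f (act w x) = f x"
      if wx: "w \<in> carrier W" "x \<in> Y" for w x
      using act[OF wx] wx(2) by (metis option.inject restrict_apply')
    then show ?thesis by auto
  qed
  have "carrier (invariant_ring A Y (\<phi> ` carrier W)) = {b \<in> (\<lambda>f. restrict f Y) ` A.
      \<forall>\<gamma>\<in>\<phi> ` carrier W. \<forall>x\<in>Y. \<forall>y. \<gamma> x = Some y \<longrightarrow> b y = b x}"
    by (simp add: invariant_ring_def Y.carrier_CR)
  also have "\<dots> = (\<lambda>f. restrict f Y) ` {f \<in> A.
      \<forall>\<gamma>\<in>\<phi> ` carrier W. \<forall>x\<in>Y. \<forall>y. \<gamma> x = Some y \<longrightarrow> restrict f Y y = restrict f Y x}"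
    by blast
  also have "\<dots> = (\<lambda>f. restrict f Y) ` W_invariants"
    unfolding * W_invariants_def ..
  finally show ?thesis .
qed

section \<open>Consequences of the isomorphism of function fields\<close>

lemma open_Y: "openin (subtopology (zariski_topology A) Y) Y"
  by (simp add: openin_subtopology_refl)

lemma as_fraction_U_in_invariant_field:
  assumes "a \<in> inv_functions"
  shows "as_fraction U.CR a \<in> carrier (invariant_field A UNIV \<Gamma>)"
proof -
  have "\<one>\<^bsub>U.CR\<^esub> = 1" "\<zero>\<^bsub>invariant_ring A UNIV \<Gamma>\<^esub> = 0"
    unfolding invariant_ring_eq by (auto simp: coordinate_ring_def fun_eq_iff)
  then show ?thesis
    unfolding frac carrier_invariant_ring as_fraction_def using assms
    by (intro CollectI exI[of _ a] exI[of _ "1 :: 'a \<Rightarrow> complex"]) simp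
qed

lemma rational_restriction_eqI:
  assumes "restricts_to A Y q h" shows "rational_restriction A Y q = h"
  unfolding rational_restriction_def
proof (rule the_equality)
  show "k = h" if "restricts_to A Y q k" for k
    using Y.generically_equal_trans_unique assms that unfolding restricts_to_def by blast
qed (rule assms)

lemma rational_restriction_as_fraction:
  assumes "a \<in> inv_functions"
  shows "rational_restriction A Y (as_fraction U.CR a) = as_fraction CY (restrict a Y)"
proof (rule rational_restriction_eqI)
  have a: "a \<in> A" using assms inv_functions_subset by blast
  then have aY: "restrict a Y \<in> carrier CY" by (rule Y.restrict_mem_CR)
  have "as_fraction CY (restrict a Y) \<in> carrier (function_field A Y)"
    using ring_hom_closed[OF Y.CR.as_fraction_ring_hom aY] by (simp add: function_field_def)
  moreover have "rational_function UNIV (as_fraction U.CR a) x = Some (a x)"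
    "rational_function Y (as_fraction CY (restrict a Y)) x = Some (a x)" if "x \<in> Y" for x
    using U.rational_function_as_fraction[of a x] Y.rational_function_as_fraction[OF aY that] a that
    by (simp_all add: carrier_U_CR)
  ultimately show "restricts_to A Y (as_fraction U.CR a) (as_fraction CY (restrict a Y))"
    unfolding restricts_to_def generically_equal_def
    using open_Y Y.Y_nonempty by (intro conjI exI[of _ Y]) auto
qed

lemma rational_restriction_bij:
  "bij_betw (rational_restriction A Y) (carrier (invariant_field A UNIV \<Gamma>))
    (carrier (invariant_field A Y (\<phi> ` carrier W)))"
  using restriction_iso unfolding ring_iso_def by blast

text \<open>Inherited from injectivity of the restriction on \<open>C(V)^G\<close>, applied to
  fractions with denominator 1.\<close>

lemma restriction_inj:
  assumes "a \<in> inv_functions" "a' \<in> inv_functions" "\<forall>x\<in>Y. a x = a' x"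
  shows "a = a'"
proof -
  have "restrict a Y = restrict a' Y" using assms(3) by (auto simp: restrict_def fun_eq_iff)
  then have "rational_restriction A Y (as_fraction U.CR a) = rational_restriction A Y (as_fraction U.CR a')"
    by (simp add: rational_restriction_as_fraction assms del: restrict_apply)
  then have "as_fraction U.CR a = as_fraction U.CR a'"
    using rational_restriction_bij as_fraction_U_in_invariant_field assms(1,2)
    unfolding bij_betw_def by (meson inj_onD)
  then show ?thesis
    using U.CR.as_fraction_eq_iff[of a a'] assms(1,2) inv_functions_subset by (auto simp: carrier_U_CR)
qed

lemma as_fraction_W_invariant:
  assumes "f \<in> W_invariants"
  shows "as_fraction CY (restrict f Y) \<in> carrier (invariant_field A Y (\<phi> ` carrier W))"
proof -
  let ?q = "as_fraction CY (restrict f Y)"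
  have fY: "restrict f Y \<in> carrier CY" using assms unfolding W_invariants_def by (auto intro: Y.restrict_mem_CR)
  have rat: "rational_function Y ?q x = Some (f x)" if "x \<in> Y" for x
    using Y.rational_function_as_fraction[OF fY that] that by simp
  have "?q \<in> carrier (function_field A Y)"
    using ring_hom_closed[OF Y.CR.as_fraction_ring_hom fY] by (simp add: function_field_def)
  moreover have "generically_equal A Y (rational_function Y ?q \<circ>\<^sub>m \<phi> w) (rational_function Y ?q)"
    if w: "w \<in> carrier W" for w
  proof -
    have "(rational_function Y ?q \<circ>\<^sub>m \<phi> w) x = Some (f x)" if "x \<in> Y" for x
      using act(2)[OF w that] rat[of "act w x"] assms w that
      unfolding W_invariants_def act_map_comp[OF w that] by auto
    then show ?thesis unfolding generically_equal_def
      using open_Y Y.Y_nonempty rat by (intro exI[of _ Y]) auto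
  qed
  ultimately show ?thesis unfolding invariant_field_def by auto
qed

text \<open>The field isomorphism yields invariance only generically. The translate is again a
  polynomial on \<open>Y\<close>, so the equality extends from an open subset.\<close>

lemma restriction_W_invariant: "inv_functions \<subseteq> W_invariants"
proof
  fix a assume a: "a \<in> inv_functions"
  let ?q = "as_fraction CY (restrict a Y)"
  have aA: "a \<in> A" using a inv_functions_subset by blast
  have rat: "rational_function Y ?q x = Some (a x)" if "x \<in> Y" for x
    using Y.rational_function_as_fraction[OF Y.restrict_mem_CR[OF aA] that] that by simp
  have "?q \<in> carrier (invariant_field A Y (\<phi> ` carrier W))"
    using rational_restriction_bij as_fraction_U_in_invariant_field[OF a]
    unfolding rational_restriction_as_fraction[OF a, symmetric] bij_betw_def by blast
  then have gen: "generically_equal A Y (rational_function Y ?q \<circ>\<^sub>m \<phi> w) (rational_function Y ?q)"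
    if "w \<in> carrier W" for w
    using that unfolding invariant_field_def by auto
  have "a (act w x) = a x" if w: "w \<in> carrier W" and x: "x \<in> Y" for w x
  proof -
    obtain O' where O': "openin (subtopology (zariski_topology A) Y) O'" "O' \<noteq> {}"
      "\<And>x. x \<in> O' \<Longrightarrow> (rational_function Y ?q \<circ>\<^sub>m \<phi> w) x = rational_function Y ?q x"
      using gen[OF w] unfolding generically_equal_def by blast
    obtain g where g: "g \<in> A" "\<forall>x\<in>Y. a (act w x) = g x" using act_polynomial[OF w aA] by blast
    have "g z = a z" if "z \<in> O'" for z
    proof -
      have z: "z \<in> Y" using that openin_subset[OF O'(1)] by auto
      then have "Some (a (act w z)) = Some (a z)"
        using O'(3)[OF that] act(2)[OF w z] rat z by (simp add: act_map_comp[OF w z])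
      then show ?thesis using g(2) z by auto
    qed
    then have "g x = a x" using Y.eq_if_eq_on_open[OF O'(1,2) g(1) aA] x by blast
    then show ?thesis using g(2) x by simp
  qed
  then show "a \<in> W_invariants" using aA unfolding W_invariants_def by blast
qed

text \<open>Surjectivity of the field isomorphism lifts \<open>f\<close> to \<open>C(V)^G\<close>,
  and the assumption on \<open>C(V)^G\<close> writes the lift as \<open>a / b\<close>. Clearing the
  denominator gives an identity on an open set, hence on \<open>Y\<close>.\<close>

lemma W_invariant_is_quotient:
  assumes f: "f \<in> W_invariants"
  obtains a b where "a \<in> inv_functions" "b \<in> inv_functions" "b \<noteq> 0" "\<forall>x\<in>Y. f x * b x = a x"
proof -
  let ?h = "as_fraction CY (restrict f Y)"
  have fA: "f \<in> A" using f unfolding W_invariants_def by blast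
  obtain q where q: "q \<in> carrier (invariant_field A UNIV \<Gamma>)" "rational_restriction A Y q = ?h"
    using rational_restriction_bij as_fraction_W_invariant[OF f] unfolding bij_betw_def by (metis imageE)
  \<comment> \<open>\<open>rational_restriction\<close> is a definite description; only existence of
    a restriction turns the equation in \<open>q(2)\<close> into a statement about values.\<close>
  have "restricts_to A Y q ?h"
    using restricts_exists[OF q(1)] q(2) rational_restriction_eqI by metis
  then obtain O' where O': "openin (subtopology (zariski_topology A) Y) O'" "O' \<noteq> {}"
    "\<And>x. x \<in> O' \<Longrightarrow> rational_function UNIV q x = rational_function Y ?h x"
    unfolding restricts_to_def generically_equal_def by blast
  have zero: "\<zero>\<^bsub>invariant_ring A UNIV \<Gamma>\<^esub> = 0" "\<zero>\<^bsub>U.CR\<^esub> = 0"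
    unfolding invariant_ring_eq by (auto simp: coordinate_ring_def fun_eq_iff)
  obtain a b where ab: "a \<in> inv_functions" "b \<in> inv_functions" "b \<noteq> 0" "q = fraction U.CR a b"
    using q(1) unfolding frac carrier_invariant_ring zero by blast
  have abA: "a \<in> A" "b \<in> A" using ab inv_functions_subset by blast+
  have "(f * b) x = a x" if x: "x \<in> O'" for x
  proof -
    have "x \<in> Y" using x openin_subset[OF O'(1)] by auto
    then have "rational_function UNIV q x = Some (f x)"
      using O'(3)[OF x] Y.rational_function_as_fraction[OF Y.restrict_mem_CR[OF fA]] by simp
    then show ?thesis
      using U.rational_function_SomeD(2)[of a b x "f x"] abA ab(3,4) by (simp add: carrier_U_CR zero)
  qed
  then have "\<forall>x\<in>Y. (f * b) x = a x"
    using Y.eq_if_eq_on_open[OF O'(1,2) mult[OF fA abA(2)] abA(1)] by blast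
  then show ?thesis using that ab by simp
qed

text \<open>Surjectivity of the restriction onto \<open>C[Y]^W\<close>, the part of the Chevalley
  property that is not automatic here. All four conditions are reduced to it.\<close>

definition chevalley :: bool where
  "chevalley \<longleftrightarrow> (\<forall>f\<in>W_invariants. \<exists>a\<in>inv_functions. \<forall>x\<in>Y. f x = a x)"

lemma chevalley_restriction_property_iff:
  "chevalley_restriction_property A \<Gamma> Y W \<phi> \<longleftrightarrow> chevalley"
proof -
  let ?R = "invariant_ring A UNIV \<Gamma>" and ?S = "invariant_ring A Y (\<phi> ` carrier W)"
  let ?r = "\<lambda>f :: 'a \<Rightarrow> complex. restrict f Y"
  have hom: "?r \<in> ring_hom ?R ?S"
  proof (rule ring_hom_memI)
    fix x assume "x \<in> carrier ?R"
    then show "?r x \<in> carrier ?S"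
      using restriction_W_invariant unfolding carrier_invariant_ring carrier_invariant_ring_W by blast
  qed (auto simp: invariant_ring_def coordinate_ring_def fun_eq_iff)
  have inj: "inj_on ?r (carrier ?R)"
    unfolding carrier_invariant_ring
  proof (rule inj_onI)
    fix a b assume ab: "a \<in> inv_functions" "b \<in> inv_functions" "?r a = ?r b"
    have "a x = b x" if "x \<in> Y" for x using fun_cong[OF ab(3), of x] that by simp
    then show "a = b" using restriction_inj[OF ab(1,2)] by blast
  qed
  have eq_iff: "?r f = ?r a \<longleftrightarrow> (\<forall>x\<in>Y. f x = a x)" for f a
    by (auto simp: restrict_def fun_eq_iff)
  have "?r ` carrier ?R = carrier ?S \<longleftrightarrow> carrier ?S \<subseteq> ?r ` carrier ?R"
    using restriction_W_invariant unfolding carrier_invariant_ring carrier_invariant_ring_W by blast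
  also have "\<dots> \<longleftrightarrow> (\<forall>f\<in>W_invariants. \<exists>a\<in>inv_functions. ?r f = ?r a)"
    unfolding carrier_invariant_ring carrier_invariant_ring_W by blast
  finally have "?r ` carrier ?R = carrier ?S \<longleftrightarrow> chevalley"
    unfolding chevalley_def eq_iff .
  then show ?thesis
    unfolding chevalley_restriction_property_def ring_iso_def bij_betw_def closed_subvariety_def
    using hom inj Y_closed Y_irreducible W_group W_finite action by blast
qed

section \<open>Invariants as quotients, and the positive closure\<close>

lemma act_cancel:
  assumes w: "w \<in> carrier W" and fg: "f \<in> A" "b \<in> W_invariants" "a \<in> W_invariants"
    and b: "\<not> (\<forall>x\<in>Y. b x = 0)" and eq: "\<forall>x\<in>Y. f x * b x = a x" and x: "x \<in> Y"
  shows "f (act w x) = f x"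
proof -
  obtain g where g: "g \<in> A" "\<forall>x\<in>Y. f (act w x) = g x" using act_polynomial[OF w fg(1)] by blast
  have "(g - f) z * b z = 0" if z: "z \<in> Y" for z
  proof -
    have "f (act w z) * b z = f z * b z"
      using eq act(2)[OF w z] z fg(2,3) w unfolding W_invariants_def by force
    then show ?thesis using g(2) z by (simp add: algebra_simps)
  qed
  moreover have "b \<in> A" using fg(2) unfolding W_invariants_def by blast
  ultimately have "(g - f) x = 0"
    using Y.integral[of "g - f" b] diff[OF g(1) fg(1)] b x by blast
  then show ?thesis using g(2) x by simp
qed

text \<open>The converse of \<open>W_invariant_is_quotient\<close>. The denominator is nonzero on
  \<open>Y\<close> because restriction is injective on invariants, so it can be cancelled.\<close>

lemma W_invariant_if_quotient:
  assumes "f \<in> A" "a \<in> inv_functions" "b \<in> inv_functions" "b \<noteq> 0" "\<forall>x\<in>Y. f x * b x = a x"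
  shows "f \<in> W_invariants"
proof -
  have "\<not> (\<forall>x\<in>Y. b x = 0)" using restriction_inj[OF assms(3) G.zero] assms(4) by auto
  then have "f (act w x) = f x" if "w \<in> carrier W" "x \<in> Y" for w x
    using act_cancel[OF that(1) assms(1) _ _ _ assms(5) that(2)] assms(2,3) restriction_W_invariant by blast
  then show ?thesis using assms(1) unfolding W_invariants_def by blast
qed

text \<open>If \<open>C[Y]\<close> lies in the positive closure, a \<open>W\<close>-invariant
  \<open>f\<close> belongs to both \<open>A[f]\<close> and \<open>Frac A\<close>, hence to
  \<open>A\<close>. Conversely \<open>A[f]\<close> meets \<open>Frac A\<close> inside
  \<open>C[Y]^W\<close>, which is \<open>A\<close> under \<open>chevalley\<close>.\<close>

lemma positive_closure_iff:
  fixes K :: "('k, 'c) ring_scheme"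
  assumes K: "field K" and \<iota>: "\<iota> \<in> ring_hom (function_field A Y) K"
    and j: "\<forall>q\<in>carrier (invariant_field A UNIV \<Gamma>). \<iota> (rational_restriction A Y q) = j q"
  shows "\<iota> ` as_fraction CY ` carrier CY
      \<subseteq> positive_closure K (j ` as_fraction U.CR ` carrier (invariant_ring A UNIV \<Gamma>)) \<longleftrightarrow> chevalley"
proof -
  interpret K: field K by fact
  define e where "e = \<iota> \<circ> as_fraction CY"
  have \<iota>': "\<iota> \<in> ring_hom (fraction_field CY) K" using \<iota> unfolding function_field_def .
  have e_hom: "e \<in> ring_hom CY K"
    unfolding e_def by (rule ring_hom_trans[OF Y.CR.as_fraction_ring_hom \<iota>'])
  interpret e: ring_hom_cring CY K e
    by (intro ring_hom_cringI e_hom Y.CR.is_cring K.is_cring)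
  have e_inj: "inj_on e (carrier CY)"
    unfolding e_def by (rule Y.CR.fraction_field_hom_inj[OF K \<iota>'])
  \<comment> \<open>The embedding into \<open>K\<close> pulled back to polynomials on
    \<open>V\<close>; it identifies exactly those that agree on \<open>Y\<close>.\<close>
  define E where "E f = e (restrict f Y)" for f
  have E_closed: "E f \<in> carrier K" if "f \<in> A" for f
    unfolding E_def using e.hom_closed[OF Y.restrict_mem_CR[OF that]] .
  have E_add: "E (f + g) = E f \<oplus>\<^bsub>K\<^esub> E g" if "f \<in> A" "g \<in> A" for f g
    unfolding E_def using e.hom_add[OF Y.restrict_mem_CR[OF that(1)] Y.restrict_mem_CR[OF that(2)]]
    by (simp only: Y.add_CR Y.restrict_add)
  have E_mult: "E (f * g) = E f \<otimes>\<^bsub>K\<^esub> E g" if "f \<in> A" "g \<in> A" for f g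
    unfolding E_def using e.hom_mult[OF Y.restrict_mem_CR[OF that(1)] Y.restrict_mem_CR[OF that(2)]]
    by (simp only: Y.mult_CR Y.restrict_mult)
  have E_eq_iff: "E f = E g \<longleftrightarrow> (\<forall>x\<in>Y. f x = g x)" if "f \<in> A" "g \<in> A" for f g
    unfolding E_def
    using inj_on_eq_iff[OF e_inj Y.restrict_mem_CR[OF that(1)] Y.restrict_mem_CR[OF that(2)]]
    by (auto simp: restrict_def fun_eq_iff)
  have "restrict (0 :: 'a \<Rightarrow> complex) Y = \<zero>\<^bsub>CY\<^esub>" "restrict (1 :: 'a \<Rightarrow> complex) Y = \<one>\<^bsub>CY\<^esub>"
    by (auto simp: Y.zero_CR Y.one_CR fun_eq_iff)
  then have E_0: "E 0 = \<zero>\<^bsub>K\<^esub>" and E_1: "E 1 = \<one>\<^bsub>K\<^esub>" unfolding E_def by simp_all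
  define R where "R = E ` inv_functions"
  have CY_image: "\<iota> ` as_fraction CY ` carrier CY = E ` A"
    unfolding E_def e_def Y.carrier_CR by (simp add: image_image)
  have R_eq: "j ` as_fraction U.CR ` carrier (invariant_ring A UNIV \<Gamma>) = R"
  proof -
    have "j (as_fraction U.CR a) = E a" if "a \<in> inv_functions" for a
      using j as_fraction_U_in_invariant_field[OF that] rational_restriction_as_fraction[OF that]
      unfolding E_def e_def by (metis comp_apply)
    then show ?thesis unfolding R_def carrier_invariant_ring by (force simp: image_image)
  qed
  have ER: "a \<in> A" "E a \<in> carrier K" "E a \<in> R" if "a \<in> inv_functions" for a
    using that inv_functions_subset E_closed unfolding R_def by blast+
  have E_nonzero: "E b \<noteq> \<zero>\<^bsub>K\<^esub>" if "b \<in> inv_functions" "b \<noteq> 0" for b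
    using E_eq_iff[OF ER(1)[OF that(1)] zero] restriction_inj[OF that(1) G.zero] that(2) E_0 by auto
  \<comment> \<open>Inside \<open>K\<close> this is
    \<open>C[Y] \<inter> Frac A = C[Y]^W\<close>.\<close>
  have frac_iff: "E f \<in> fractions_in K R \<longleftrightarrow> f \<in> W_invariants" if f: "f \<in> A" for f
  proof
    assume "E f \<in> fractions_in K R"
    then obtain a b where ab: "a \<in> inv_functions" "b \<in> inv_functions" "E b \<noteq> \<zero>\<^bsub>K\<^esub>"
      "E f = E a \<otimes>\<^bsub>K\<^esub> inv\<^bsub>K\<^esub> (E b)"
      unfolding fractions_in_def R_def by blast
    have "E b \<in> Units K" using ab(3) ER(2)[OF ab(2)] by (simp add: K.field_Units)
    then have "E f \<otimes>\<^bsub>K\<^esub> E b = E a"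
      unfolding ab(4) using ER(2) ab(1,2) by (simp add: K.m_assoc)
    then have "E (f * b) = E a" using E_mult[OF f ER(1)[OF ab(2)]] by simp
    then have "\<forall>x\<in>Y. f x * b x = a x" using E_eq_iff[OF mult[OF f ER(1)[OF ab(2)]] ER(1)[OF ab(1)]] by simp
    moreover have "b \<noteq> 0" using ab(3) E_0 by blast
    ultimately show "f \<in> W_invariants" using W_invariant_if_quotient[OF f ab(1,2)] by blast
  next
    assume "f \<in> W_invariants"
    then obtain a b where ab: "a \<in> inv_functions" "b \<in> inv_functions" "b \<noteq> 0" "\<forall>x\<in>Y. f x * b x = a x"
      by (rule W_invariant_is_quotient)
    have "E (f * b) = E a" using E_eq_iff[OF mult[OF f ER(1)[OF ab(2)]] ER(1)[OF ab(1)]] ab(4) by simp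
    then have "E a = E f \<otimes>\<^bsub>K\<^esub> E b" using E_mult[OF f ER(1)[OF ab(2)]] by simp
    moreover have "E b \<in> Units K" using E_nonzero ab(2,3) ER(2)[OF ab(2)] by (simp add: K.field_Units)
    ultimately have "E f = E a \<otimes>\<^bsub>K\<^esub> inv\<^bsub>K\<^esub> (E b)"
      using E_closed[OF f] ER(2)[OF ab(2)] by (simp add: K.m_assoc)
    then show "E f \<in> fractions_in K R"
      unfolding fractions_in_def using ER(3)[OF ab(1)] ER(3)[OF ab(2)] E_nonzero[OF ab(2,3)] by blast
  qed
  have zero_A: "0 \<in> A" by (rule zero)
  have simple_A: "K.simple_extension R (E f) \<subseteq> E ` A" if f: "f \<in> A" for f
  proof
    fix x assume "x \<in> K.simple_extension R (E f)"
    then show "x \<in> E ` A"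
    proof (induction rule: K.simple_extension.induct)
      case zero
      then show ?case unfolding E_0[symmetric] using zero_A by (rule imageI)
    next
      case (lin k1 k2)
      then obtain g a where ga: "g \<in> A" "k1 = E g" "a \<in> A" "k2 = E a"
        using inv_functions_subset unfolding R_def by blast
      have "k1 \<otimes>\<^bsub>K\<^esub> E f \<oplus>\<^bsub>K\<^esub> k2 = E (g * f + a)"
        unfolding ga using E_add[OF mult[OF ga(1) f] ga(3)] E_mult[OF ga(1) f] by simp
      then show ?case using add[OF mult[OF ga(1) f] ga(3)] by blast
    qed
  qed
  have R_simple: "R \<subseteq> K.simple_extension R (E f)" and f_simple: "E f \<in> K.simple_extension R (E f)"
    if f: "f \<in> A" for f
  proof -
    have RK: "R \<subseteq> carrier K" using ER(2) unfolding R_def by blast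
    show "R \<subseteq> K.simple_extension R (E f)" by (rule K.simple_extension_incl[OF RK E_closed[OF f]])
    then have "\<one>\<^bsub>K\<^esub> \<in> K.simple_extension R (E f)" using ER(3)[OF G.one] E_1 by auto
    \<comment> \<open>The extension is built by Horner steps \<open>k1 * x + k2\<close>; here
      \<open>k1 = 1\<close> and \<open>k2 = 0\<close>.\<close>
    from K.simple_extension.lin[OF this, of "\<zero>\<^bsub>K\<^esub>"] show "E f \<in> K.simple_extension R (E f)"
      using ER(3)[OF G.zero] E_0 E_closed[OF f] by simp
  qed
  have R_frac: "R \<subseteq> fractions_in K R"
    using frac_iff ER(1) restriction_W_invariant unfolding R_def by blast
  show ?thesis
    unfolding CY_image R_eq
  proof
    assume sub: "E ` A \<subseteq> positive_closure K R"
    show chevalley unfolding chevalley_def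
    proof
      fix f assume f: "f \<in> W_invariants"
      then have fA: "f \<in> A" unfolding W_invariants_def by blast
      then have "K.simple_extension R (E f) \<inter> fractions_in K R = R"
        using sub unfolding positive_closure_def by blast
      then have "E f \<in> R" using f_simple[OF fA] frac_iff[OF fA] f by blast
      then obtain a where "a \<in> inv_functions" "E f = E a" unfolding R_def by blast
      then show "\<exists>a\<in>inv_functions. \<forall>x\<in>Y. f x = a x" using E_eq_iff[OF fA ER(1)] by blast
    qed
  next
    assume chev: chevalley
    have "K.simple_extension R (E f) \<inter> fractions_in K R \<subseteq> R" if f: "f \<in> A" for f
    proof
      fix x assume x: "x \<in> K.simple_extension R (E f) \<inter> fractions_in K R"
      then obtain g where g: "g \<in> A" "x = E g" using simple_A[OF f] by blast
      then have "g \<in> W_invariants" using x frac_iff by blast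
      then obtain a where a: "a \<in> inv_functions" "\<forall>x\<in>Y. g x = a x" using chev unfolding chevalley_def by blast
      then show "x \<in> R" using E_eq_iff[OF g(1) ER(1)[OF a(1)]] g(2) unfolding R_def by blast
    qed
    then show "E ` A \<subseteq> positive_closure K R"
      using R_simple R_frac E_closed unfolding positive_closure_def by blast
  qed
qed

section \<open>Surjectivity of the quotient morphism\<close>

abbreviation "\<pi> \<equiv> quotient_morphism A \<Gamma> Y"

lemma quotient_morphism_eq: "y \<in> Y \<Longrightarrow> \<pi> y = {f \<in> inv_functions. f y = 0}"
  unfolding quotient_morphism_def carrier_invariant_ring by auto

lemma quotient_morphism_maximal: "y \<in> Y \<Longrightarrow> maximalideal (\<pi> y) G.SR"
  unfolding quotient_morphism_eq by (rule G.maximalideal_kernel[of "\<lambda>f. f y"]) auto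

text \<open>The averaging operator without the factor \<open>1 / |W|\<close>. Only its values on
  \<open>Y\<close> are meaningful, since \<open>act w x\<close> is unspecified elsewhere.\<close>

definition avg :: "('a \<Rightarrow> complex) \<Rightarrow> 'a \<Rightarrow> complex" where
  "avg f x = (\<Sum>w\<in>carrier W. f (act w x))"

text \<open>Each summand is a polynomial on \<open>Y\<close>, and acting by \<open>v\<close>
  permutes the summands through right multiplication.\<close>

lemma avg_W_invariant:
  assumes "f \<in> A"
  obtains g where "g \<in> W_invariants" "\<forall>x\<in>Y. avg f x = g x"
proof -
  have "\<forall>w\<in>carrier W. \<exists>g\<in>A. \<forall>x\<in>Y. f (act w x) = g x" using act_polynomial[OF _ assms] by metis
  then obtain h where h: "\<And>w. w \<in> carrier W \<Longrightarrow> h w \<in> A" "\<And>w x. w \<in> carrier W \<Longrightarrow> x \<in> Y \<Longrightarrow> f (act w x) = h w x"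
    by metis
  have sum_app: "(\<Sum>w\<in>S. h w) x = (\<Sum>w\<in>S. h w x)" for S x
    by (induction S rule: infinite_finite_induct) auto
  define g where "g = (\<Sum>w\<in>carrier W. h w)"
  have g: "avg f x = g x" if "x \<in> Y" for x
    unfolding avg_def g_def sum_app using h(2) that by (intro sum.cong) auto
  have inv: "avg f (act v x) = avg f x" if v: "v \<in> carrier W" and x: "x \<in> Y" for v x
  proof -
    have "avg f (act v x) = (\<Sum>w\<in>carrier W. f (act (w \<otimes>\<^bsub>W\<^esub> v) x))"
      unfolding avg_def using act_mult[OF _ v x] by (intro sum.cong) auto
    also have "\<dots> = (\<Sum>w\<in>(\<lambda>w. w \<otimes>\<^bsub>W\<^esub> v) ` carrier W. f (act w x))"
      using W.inj_on_multc[OF v] by (simp add: sum.reindex)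
    also have "(\<lambda>w. w \<otimes>\<^bsub>W\<^esub> v) ` carrier W = carrier W"
    proof
      show "carrier W \<subseteq> (\<lambda>w. w \<otimes>\<^bsub>W\<^esub> v) ` carrier W"
      proof
        fix u assume "u \<in> carrier W"
        then show "u \<in> (\<lambda>w. w \<otimes>\<^bsub>W\<^esub> v) ` carrier W"
          using v by (intro image_eqI[of _ _ "u \<otimes>\<^bsub>W\<^esub> inv\<^bsub>W\<^esub> v"]) (simp_all add: W.m_assoc)
      qed
    qed (use v in auto)
    finally show ?thesis unfolding avg_def .
  qed
  have "g \<in> W_invariants"
    unfolding W_invariants_def using inv g act(2) h(1) by (auto simp: g_def intro!: sum)
  then show ?thesis using that g by blast
qed

text \<open>
  Averaging over \<open>W\<close> shows that a maximal ideal of the invariants generates a proper ideal on \<open>Y\<close>.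
\<close>

lemma chevalley_imp_surjective:
  assumes chev: chevalley
  shows "surjective_onto \<pi> Y G.Z"
proof -
  have "\<exists>y\<in>Y. m = \<pi> y" if m: "maximalideal m G.SR" for m
  proof -
    note mI = G.maximalidealD[OF m]
    \<comment> \<open>This ideal contains \<open>m\<close> and all functions vanishing on
      \<open>Y\<close>. Testing the averages of all multiples \<open>g * b\<close> replaces
      computing with sums of generators and makes closure under multiplication immediate.\<close>
    define J where "J = {g \<in> A. \<forall>b\<in>A. \<exists>a\<in>m. \<forall>x\<in>Y. avg (g * b) x = a x}"
    have J: "is_ideal J"
    proof (rule is_idealI)
      show "J \<subseteq> A" unfolding J_def by blast
      show "0 \<in> J" unfolding J_def using G.is_idealD(2)[OF mI(1)]
        by (auto simp: avg_def intro!: bexI[of _ 0])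
    next
      fix f g assume fg: "f \<in> J" "g \<in> J"
      have "\<exists>a\<in>m. \<forall>x\<in>Y. avg ((f + g) * b) x = a x" if b: "b \<in> A" for b
      proof -
        obtain a a' where a: "a \<in> m" "\<forall>x\<in>Y. avg (f * b) x = a x" "a' \<in> m" "\<forall>x\<in>Y. avg (g * b) x = a' x"
          using fg b unfolding J_def by blast
        have "avg ((f + g) * b) x = avg (f * b) x + avg (g * b) x" for x
          unfolding avg_def by (simp add: sum.distrib[symmetric] algebra_simps)
        then show ?thesis using a G.is_idealD(3)[OF mI(1) a(1,3)] by (intro bexI[of _ "a + a'"]) auto
      qed
      then show "f + g \<in> J" using fg add unfolding J_def by blast
    next
      fix f g assume fg: "f \<in> A" "g \<in> J"
      have "\<exists>a\<in>m. \<forall>x\<in>Y. avg ((f * g) * b) x = a x" if b: "b \<in> A" for b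
      proof -
        have eq: "f * g * b = g * (f * b)" by (simp add: mult_ac)
        have "f * b \<in> A" using fg(1) b by (rule mult)
        then show ?thesis using fg(2) unfolding J_def eq by blast
      qed
      then show "f * g \<in> J" using fg mult unfolding J_def by blast
    qed
    \<comment> \<open>The average of 1 is the constant \<open>|W|\<close>, a nonzero complex number,
      and a proper ideal contains no such constant.\<close>
    have "1 \<notin> J"
    proof
      assume "1 \<in> J"
      then obtain a where a: "a \<in> m" "\<forall>x\<in>Y. avg (1 * 1) x = a x" unfolding J_def by blast
      have "a = (\<lambda>_. of_nat (card (carrier W)))"
        by (rule restriction_inj) (use a G.is_idealD(1)[OF mI(1)] in \<open>auto simp: avg_def\<close>)
      moreover have "card (carrier W) \<noteq> 0" using W_finite W.one_closed by auto
      ultimately have "(\<lambda>_. inverse (of_nat (card (carrier W)))) * a = 1" by (auto simp: fun_eq_iff)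
      then show False using G.is_idealD(4)[OF mI(1) G.const a(1)] mI(2) by metis
    qed
    then obtain y where y: "\<forall>f\<in>J. f y = 0" using nullstellensatz[OF J] by blast
    have "y \<in> Y"
    proof (rule ccontr)
      assume "y \<notin> Y"
      then obtain f where f: "f \<in> A" "f y \<noteq> 0" "\<forall>z\<in>Y. f z = 0" using closedin_zariskiD[OF Y_closed] by blast
      have "avg (f * b) x = 0" if "x \<in> Y" for b x
        unfolding avg_def using f(3) act(2) that by (intro sum.neutral) auto
      then have "f \<in> J" unfolding J_def
        using f(1) G.is_idealD(2)[OF mI(1)] by (auto intro!: bexI[of _ 0])
      then show False using y f(2) by blast
    qed
    \<comment> \<open>For \<open>a\<close> in \<open>m\<close> the average of \<open>a * b\<close>
      is \<open>a\<close> times the average of \<open>b\<close>, which is \<open>W\<close>-invariant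
      and so comes from \<open>A\<close> by \<open>chevalley\<close>.\<close>
    have "m \<subseteq> J"
    proof
      fix a assume a: "a \<in> m"
      have aG: "a \<in> inv_functions" using a G.is_idealD(1)[OF mI(1)] by blast
      have aW: "a \<in> W_invariants" using aG restriction_W_invariant by blast
      have "\<exists>c\<in>m. \<forall>x\<in>Y. avg (a * b) x = c x" if b: "b \<in> A" for b
      proof -
        obtain g where g: "g \<in> W_invariants" "\<forall>x\<in>Y. avg b x = g x" using avg_W_invariant[OF b] by blast
        obtain c where c: "c \<in> inv_functions" "\<forall>x\<in>Y. g x = c x" using chev g(1) unfolding chevalley_def by blast
        have "avg (a * b) x = a x * avg b x" if "x \<in> Y" for x
          unfolding avg_def sum_distrib_left using aW that unfolding W_invariants_def by (intro sum.cong) auto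
        then show ?thesis using g(2) c G.is_idealD(5)[OF mI(1) c(1) a] by (intro bexI[of _ "a * c"]) auto
      qed
      then show "a \<in> J" using aG inv_functions_subset unfolding J_def by blast
    qed
    then have "m \<subseteq> \<pi> y"
      using y G.is_idealD(1)[OF mI(1)] unfolding quotient_morphism_eq[OF \<open>y \<in> Y\<close>] by blast
    then have "\<pi> y = m"
      using mI(4)[of "\<pi> y"] G.maximalidealD(1,2)[OF quotient_morphism_maximal[OF \<open>y \<in> Y\<close>]] by blast
    then show ?thesis using \<open>y \<in> Y\<close> by blast
  qed
  then show ?thesis
    using quotient_morphism_maximal unfolding surjective_onto_def G.topspace_Z by auto
qed

text \<open>The missed set is empty, and irreducible components are nonempty, so there is none to
  test.\<close>

lemma surjective_imp_codim_two:
  assumes "surjective_onto \<pi> Y G.Z" shows "surjective_up_to_codim_two \<pi> Y G.Z"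
  using assms
  by (auto simp: surjective_up_to_codim_two_def surjective_onto_def irreducible_component_def
      irreducible_subset_def)

text \<open>
  A prime dividing the denominator but not the numerator of a regular invariant function on \<open>Y\<close>
  would cut out a divisor whose generic point is missed by \<open>Y\<close>.
\<close>

lemma codim_two_imp_chevalley:
  assumes surj: "surjective_up_to_codim_two \<pi> Y G.Z"
  shows chevalley
  unfolding chevalley_def
proof
  fix f assume f: "f \<in> W_invariants"
  then have fA: "f \<in> A" unfolding W_invariants_def by blast
  obtain a b where ab: "a \<in> inv_functions" "b \<in> inv_functions" "b \<noteq> 0" "\<forall>x\<in>Y. f x * b x = a x"
    using W_invariant_is_quotient[OF f] by blast
  \<comment> \<open>The numerator is quantified inside the induction, since cancelling a prime from
    the denominator changes it.\<close>
  have "\<forall>a\<in>inv_functions. (\<forall>x\<in>Y. f x * b x = a x) \<longrightarrow> (\<exists>a\<in>inv_functions. \<forall>x\<in>Y. f x = a x)"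
    using ab(2,3)
  proof (induction rule: G.factorial_induct)
    case (unit u v)
    show ?case
    proof (intro ballI impI)
      fix a assume a: "a \<in> inv_functions" "\<forall>x\<in>Y. f x * u x = a x"
      have "f x = (a * v) x" if "x \<in> Y" for x
      proof -
        have "u x * v x = 1" using fun_cong[OF unit(3), of x] by simp
        then have "f x = f x * u x * v x" by (simp add: mult.assoc)
        then show ?thesis using a(2) that by simp
      qed
      then show "\<exists>a\<in>inv_functions. \<forall>x\<in>Y. f x = a x" using G.mult[OF a(1) unit(2)] by blast
    qed
  next
    case (prime p c)
    show ?case
    proof (intro ballI impI)
      fix a assume a: "a \<in> inv_functions" "\<forall>x\<in>Y. f x * (p * c) x = a x"
      have p: "p \<in> inv_functions" "p \<noteq> 0" using prime(1) unfolding G.prime_element_def by auto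
      have "a \<in> G.multiples p"
      proof (rule ccontr)
        assume na: "a \<notin> G.multiples p"
        \<comment> \<open>Where \<open>p\<close> vanishes on \<open>Y\<close>, so does
          \<open>a = f * p * c\<close>; the image therefore cannot meet \<open>V p\<close> outside
          the zeros of \<open>a\<close>.\<close>
        have "m \<notin> \<pi> ` Y" if m: "m \<in> G.V p" "a \<notin> m" for m
        proof
          assume "m \<in> \<pi> ` Y"
          then obtain y where y: "y \<in> Y" "m = \<pi> y" by blast
          have "p y = 0" using m(1) y unfolding G.V_def by (auto simp: quotient_morphism_eq)
          then have "a y = 0" using a(2) y(1) by auto
          then show False using m(2) a(1) y by (simp add: quotient_morphism_eq)
        qed
        then show False using G.not_surjective_up_to_codim_two[OF prime(1) a(1) na] surj by blast
      qed
      then obtain a' where a': "a' \<in> inv_functions" "a = p * a'" unfolding G.multiples_def by blast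
      have pc: "p \<in> A" "c \<in> A" "a' \<in> A" using p(1) prime(2) a'(1) inv_functions_subset by blast+
      have "p x * (f * c - a') x = 0" if "x \<in> Y" for x
        using a(2) a'(2) that by (simp add: algebra_simps)
      \<comment> \<open>A nonzero invariant stays nonzero on \<open>Y\<close>, so \<open>p\<close>
        cancels from both sides on the irreducible \<open>Y\<close>.\<close>
      moreover have "\<not> (\<forall>x\<in>Y. p x = 0)" using restriction_inj[OF p(1) G.zero] p(2) by auto
      ultimately have "\<forall>x\<in>Y. (f * c - a') x = 0"
        using Y.integral[OF pc(1) diff[OF mult[OF fA pc(2)] pc(3)]] by blast
      then have "\<forall>x\<in>Y. f x * c x = a' x" by simp
      then show "\<exists>a\<in>inv_functions. \<forall>x\<in>Y. f x = a x" using prime(4) a'(1) by blast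
    qed
  qed
  then show "\<exists>a\<in>inv_functions. \<forall>x\<in>Y. f x = a x" using ab(1,4) by blast
qed

end

text \<open>The maps \<open>j\<close> and \<open>\<iota>\<close> make the inclusions into the
  algebraic closure explicit; the last assumption says that \<open>\<iota>\<close> is an embedding
  over \<open>C(V)^G\<close>. The assumption \<open>regular\<close> is the setting in which the
  Chevalley property is defined.\<close>

theorem theorem3:
  fixes s :: "complex \<Rightarrow> 'v::ab_group_add \<Rightarrow> 'v"
    and B :: "'v set"
    and G :: "(complex^'m^'m) set"
    and \<rho> :: "complex^'m^'m \<Rightarrow> 'v \<Rightarrow> 'v"
    and Y :: "'v set"
    and W :: "('w, 'b) monoid_scheme"
    and \<phi> :: "'w \<Rightarrow> 'v \<rightharpoonup> 'v"
    and K :: "('k, 'c) ring_scheme"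
    and j :: "(('v \<Rightarrow> complex) \<times> ('v \<Rightarrow> complex)) set \<Rightarrow> 'k"
    and \<iota> :: "(('v \<Rightarrow> complex) \<times> ('v \<Rightarrow> complex)) set \<Rightarrow> 'k"
  defines "P \<equiv> polynomial_functions s"
    and "\<Gamma> \<equiv> group_maps G \<rho>"
  defines "CV \<equiv> coordinate_ring P UNIV"
    and "CVG \<equiv> invariant_ring P UNIV \<Gamma>"
    and "FVG \<equiv> invariant_field P UNIV \<Gamma>"
    and "CY \<equiv> coordinate_ring P Y"
    and "\<pi> \<equiv> quotient_morphism P \<Gamma> Y"
  assumes V: "finite_dimensional_vector_space s B"
    and G: "reductive_group G"
    and rep: "rational_representation G s \<rho>"
    and frac: "carrier FVG =
      {fraction CV a b | a b. a \<in> carrier CVG \<and> b \<in> carrier CVG - {\<zero>\<^bsub>CVG\<^esub>}}"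
    and ufd: "factorial_domain CVG"
    and galois: "galois_restriction_property P \<Gamma> Y W \<phi>"
    and regular: "faithful_regular_action P Y W \<phi>"
    and closure: "algebraic_closure K (j ` carrier FVG)" "j \<in> ring_hom FVG K"
    and embedding: "\<iota> \<in> ring_hom (function_field P Y) K"
      "\<forall>q\<in>carrier FVG. \<iota> (rational_restriction P Y q) = j q"
  shows "(chevalley_restriction_property P \<Gamma> Y W \<phi> \<longleftrightarrow>
            \<iota> ` as_fraction CY ` carrier CY
              \<subseteq> positive_closure K (j ` as_fraction CV ` carrier CVG)) \<and>
         (\<iota> ` as_fraction CY ` carrier CY
              \<subseteq> positive_closure K (j ` as_fraction CV ` carrier CVG) \<longleftrightarrow>
            surjective_up_to_codim_two \<pi> Y (mSpec CVG)) \<and>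
         (surjective_up_to_codim_two \<pi> Y (mSpec CVG) \<longleftrightarrow>
            surjective_onto \<pi> Y (mSpec CVG))"
proof -
  have "vector_space s" using V by (simp add: finite_dimensional_vector_space_def)
  then have irr: "irreducible_subset (zariski_topology P) UNIV"
    unfolding P_def by (rule irreducible_subset_UNIV_polynomial_functions)
  have "affine_algebra P" unfolding P_def by (rule affine_algebra_polynomial_functions[OF V])
  then interpret D: restriction_data P \<Gamma> Y W \<phi>
    using irr galois regular frac ufd
    unfolding restriction_data_def restriction_data_axioms_def FVG_def CV_def CVG_def by blast
  have K: "field K" using closure(1) unfolding algebraic_closure_def by blast
  have CVG: "mSpec CVG = D.G.Z" unfolding CVG_def D.invariant_ring_eq ..
  have "chevalley_restriction_property P \<Gamma> Y W \<phi> \<longleftrightarrow> D.chevalley"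
    by (rule D.chevalley_restriction_property_iff)
  moreover have "\<iota> ` as_fraction CY ` carrier CY
      \<subseteq> positive_closure K (j ` as_fraction CV ` carrier CVG) \<longleftrightarrow> D.chevalley"
    unfolding CY_def CV_def CVG_def
    using D.positive_closure_iff[OF K embedding(1)] embedding(2) unfolding FVG_def by blast
  moreover have "surjective_up_to_codim_two \<pi> Y (mSpec CVG) \<longleftrightarrow> D.chevalley"
    "surjective_onto \<pi> Y (mSpec CVG) \<longleftrightarrow> D.chevalley"
    unfolding CVG \<pi>_def
    using D.codim_two_imp_chevalley D.chevalley_imp_surjective D.surjective_imp_codim_two by blast+
  ultimately show ?thesis by blast
qed

end
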